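(* Let $C>0$ and let $(H_x)_{x\in\mathbb{Z}}$ be i.i.d. $[0,\infty)$-valued random variables on a probability space $(\Omega,\mathcal{G},\mathbf{P})$ with $\lim_{z\to\infty} z\,\mathbf{P}(H_0>z)=C$. Then for $\mathbf{P}$-almost every $\omega\in\Omega$, the graph $\mathrm{Comb}(\mathbb{Z},H^\omega)$ has the finite triple collision property.
   Context: For a profile $H=(H_x)_{x\in\mathbb{Z}}\in[0,\infty)^{\mathbb{Z}}$, the comb graph $\mathrm{Comb}(\mathbb{Z},H)$ has vertex set $V=\{(x,\ell)\in\mathbb{Z}\times\mathbb{N}_0: 0\le \ell\le H_x\}$; its edges are $\{(x,0),(y,0)\}$ for $|x-y|=1$, and $\{(x,\ell),(x,k)\}$ for $x\in\mathbb{Z}$, $|\ell-k|=1$ (both endpoints in $V$). $H^\omega=(H_x(\omega))_{x\in\mathbb{Z}}$. A connected, locally finite graph $G=(V,E)$ has the finite triple collision property if, for some $x\in V$, three independent discrete-time simple random walks $X^1,X^2,X^3$ on $G$, all started at $x$, satisfy that the set $\{n: X^1_n=X^2_n=X^3_n\}$ is almost surely finite. *)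

theory Defs
  imports "HOL-Probability.Probability"
begin

section \<open>Graphs\<close>

text \<open>A simple graph is given by its vertex set and its set of edges, each edge being an
  unordered pair \<open>{u, v}\<close> of distinct vertices.\<close>

definition neighbours :: "'v set set \<Rightarrow> 'v \<Rightarrow> 'v set" where
  "neighbours E v = {w. {v, w} \<in> E}"

definition connected_locally_finite_graph :: "'v set \<Rightarrow> 'v set set \<Rightarrow> bool" where
  "connected_locally_finite_graph V E \<longleftrightarrow>
     V \<noteq> {} \<and>
     (\<forall>e\<in>E. \<exists>u\<in>V. \<exists>v\<in>V. u \<noteq> v \<and> e = {u, v}) \<and>
     (\<forall>v\<in>V. finite (neighbours E v)) \<and>
     (\<forall>u\<in>V. \<forall>v\<in>V. (u, v) \<in> {(a, b). {a, b} \<in> E}\<^sup>*)"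


section \<open>Simple random walk\<close>

text \<open>The kernel for the state at time \<open>n\<close> given the trajectory before time \<open>n\<close>. At a vertex whose
  neighbourhood is empty or infinite, \<open>pmf_of_set\<close> is unspecified; on a locally finite graph
  without isolated vertices the walk never meets this case.\<close>

definition srw_kernel :: "'v set set \<Rightarrow> 'v \<Rightarrow> nat \<Rightarrow> (nat \<Rightarrow> 'v) \<Rightarrow> 'v measure" where
  "srw_kernel E x n \<omega> =
     measure_pmf (if n = 0 then return_pmf x else pmf_of_set (neighbours E (\<omega> (n - 1))))"

text \<open>The law, on the space of trajectories, of the simple random walk started at \<open>x\<close>: the
  Ionescu-Tulcea limit of the kernels above. Its finite-dimensional distributions are computed in
  \<open>srw_law_cylinder\<close>.\<close>

definition srw_law :: "'v set set \<Rightarrow> 'v \<Rightarrow> (nat \<Rightarrow> 'v) measure" where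
  "srw_law E x =
     projective_family.lim UNIV
       (Ionescu_Tulcea.CI (srw_kernel E x) (\<lambda>_. count_space UNIV)) (\<lambda>_. count_space UNIV)"

lemma measurable_srw_kernel:
  "srw_kernel E x n \<in> PiM {0..<n} (\<lambda>_. count_space UNIV) \<rightarrow>\<^sub>M subprob_algebra (count_space UNIV)"
proof -
  have step: "(\<lambda>v. measure_pmf (pmf_of_set (neighbours E v)))
      \<in> count_space UNIV \<rightarrow>\<^sub>M subprob_algebra (count_space UNIV)"
    by (auto simp: space_subprob_algebra
        intro!: prob_space_imp_subprob_space measure_pmf.prob_space_axioms)
  have past: "(\<lambda>\<omega>. \<omega> (n - 1)) \<in> PiM {0..<n} (\<lambda>_. count_space UNIV) \<rightarrow>\<^sub>M count_space UNIV" if "n \<noteq> 0"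
    using that by (intro measurable_component_singleton) simp
  show ?thesis
  proof (cases "n = 0")
    case True
    then show ?thesis
      by (auto simp: srw_kernel_def[abs_def] space_subprob_algebra
          intro!: measurable_const prob_space_imp_subprob_space measure_pmf.prob_space_axioms)
  next
    case False
    then show ?thesis
      using measurable_compose[OF past step] by (simp add: srw_kernel_def[abs_def])
  qed
qed

lemma Ionescu_Tulcea_srw: "Ionescu_Tulcea (srw_kernel E x) (\<lambda>_. count_space UNIV)"
proof (rule Ionescu_Tulcea.intro)
  show "prob_space (srw_kernel E x n \<omega>)" for n \<omega>
    by (simp add: srw_kernel_def measure_pmf.prob_space_axioms)
qed (rule measurable_srw_kernel)

lemma sets_srw_law [measurable_cong]: "sets (srw_law E x) = sets (PiM UNIV (\<lambda>_. count_space UNIV))"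
proof -
  interpret Ionescu_Tulcea "srw_kernel E x" "\<lambda>_. count_space UNIV"
    by (rule Ionescu_Tulcea_srw)
  show ?thesis
    unfolding srw_law_def by (rule PF.sets_lim)
qed

lemma space_srw_law [simp]: "space (srw_law E x) = UNIV"
  using sets_eq_imp_space_eq[OF sets_srw_law, of E x] by (simp add: space_PiM)

lemma srw_law_emeasure_cylinder:
  "emeasure (srw_law E x) {\<omega>. \<forall>i\<le>n. \<omega> i = v i} =
     ennreal (indicat_real {x} (v 0) * (\<Prod>i<n. pmf (pmf_of_set (neighbours E (v i))) (v (Suc i))))"
proof -
  let ?M = "\<lambda>_::nat. count_space (UNIV :: 'a set)"
  interpret IT: Ionescu_Tulcea "srw_kernel E x" ?M
    by (rule Ionescu_Tulcea_srw)
  define S where "S n = PiE {0..<n} (\<lambda>i. {v i})" for n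
  have S_sets [measurable]: "S n \<in> sets (PiM {0..<n} ?M)" for n
    unfolding S_def by (rule sets_PiM_I_finite) auto
  have step: "emeasure (IT.C 0 (Suc n) (\<lambda>_. undefined)) (S (Suc n)) =
      emeasure (IT.C 0 n (\<lambda>_. undefined)) (S n) * emeasure (srw_kernel E x n v) {v n}" for n
  proof -
    let ?C = "IT.C 0 n (\<lambda>_. undefined)"
    have u [simp]: "(\<lambda>_. undefined) \<in> space (PiM {0..<0} ?M)"
      by (simp add: space_PiM)
    have spC: "space ?C = space (PiM {0..<n} ?M)" 
      using IT.space_C[OF u, of n] by simp
    have setC: "sets ?C = sets (PiM {0..<n} ?M)" 
      using IT.sets_C[OF u, of n] by simp
    have mE: "IT.eP n \<in> ?C \<rightarrow>\<^sub>M subprob_algebra (PiM {0..<Suc n} ?M)"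
      using IT.measurable_eP[of n] measurable_cong_sets[OF setC refl] by blast
    have "emeasure (IT.C 0 (Suc n) (\<lambda>_. undefined)) (S (Suc n)) =
        (\<integral>\<^sup>+\<omega>. emeasure (IT.eP n \<omega>) (S (Suc n)) \<partial>?C)"
      using mE by (simp, subst emeasure_bind[where N = "PiM {0..<Suc n} ?M"])
        (auto simp: spC)
    also have "\<dots> = (\<integral>\<^sup>+\<omega>. emeasure (srw_kernel E x n v) {v n} * indicator (S n) \<omega> \<partial>?C)"
    proof (rule nn_integral_cong)
      fix \<omega> assume "\<omega> \<in> space ?C"
      then have w: "\<omega> \<in> space (PiM {0..<n} ?M)" by (simp add: spC)
      have ext: "\<omega> \<in> extensional {0..<n}" using w by (simp add: space_PiM PiE_iff)
      have eq: "{y. fun_upd \<omega> n y \<in> S (Suc n)} = (if \<omega> \<in> S n then {v n} else {})"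
        using ext unfolding S_def
        by (auto simp: PiE_iff extensional_def less_Suc_eq split: if_splits)
      have ker: "srw_kernel E x n \<omega> = srw_kernel E x n v" if "\<omega> \<in> S n"
        using that by (cases n) (auto simp: srw_kernel_def S_def PiE_iff)
      show "emeasure (IT.eP n \<omega>) (S (Suc n)) = emeasure (srw_kernel E x n v) {v n} * indicator (S n) \<omega>"
        using ker by (subst IT.emeasure_eP[OF w S_sets]) (use eq in \<open>auto simp: vimage_def\<close>)
    qed
    also have "\<dots> = emeasure (srw_kernel E x n v) {v n} * emeasure ?C (S n)"
      by (subst nn_integral_cmult_indicator) (auto simp: setC)
    finally show ?thesis by (simp add: mult.commute)
  qed
  have C: "emeasure (IT.C 0 (Suc n) (\<lambda>_. undefined)) (S (Suc n)) =
      ennreal (indicat_real {x} (v 0) * (\<Prod>i<n. pmf (pmf_of_set (neighbours E (v i))) (v (Suc i))))" for n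
  proof (induction n)
    case 0
    have "emeasure (IT.C 0 0 (\<lambda>_. undefined)) (S 0) = 1"
      by (simp add: S_def PiM_empty emeasure_return)
    moreover have "emeasure (srw_kernel E x 0 v) {v 0} = indicator {x} (v 0)"
      by (simp add: srw_kernel_def indicator_def emeasure_pmf_single)
    ultimately show ?case
      using step[of 0] by (simp add: indicator_def)
  next
    case (Suc n)
    show ?case
      unfolding step[of "Suc n"] Suc
      by (simp add: srw_kernel_def emeasure_pmf_single ennreal_mult[symmetric] prod_nonneg mult_ac)
  qed
  have cyl: "{\<omega>. \<forall>i\<le>n. \<omega> i = v i} = prod_emb UNIV ?M {0..<Suc n} (S (Suc n))"
    unfolding S_def by (auto simp: prod_emb_def space_PiM PiE_iff less_Suc_eq_le)
  have "emeasure (srw_law E x) {\<omega>. \<forall>i\<le>n. \<omega> i = v i} = emeasure (IT.CI {0..<Suc n}) (S (Suc n))"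
    unfolding srw_law_def cyl by (rule IT.lim) auto
  also have "\<dots> = emeasure (IT.C 0 (Suc n) (\<lambda>_. undefined)) (S (Suc n))"
  proof -
    have "prod_emb {0..<Suc n} ?M {0..<Suc n} (S (Suc n)) = S (Suc n)"
      by (rule prod_emb_id) (auto simp: S_def PiE_iff)
    then show ?thesis
      using IT.emeasure_CI[OF order_refl S_sets[of "Suc n"]] by metis
  qed
  finally show ?thesis
    using C by simp
qed

lemma prob_space_srw_law: "prob_space (srw_law E x)"
proof -
  interpret Ionescu_Tulcea "srw_kernel E x" "\<lambda>_. count_space UNIV"
    by (rule Ionescu_Tulcea_srw)
  show ?thesis
    unfolding srw_law_def
  proof (rule prob_space_distrD)
    show "(\<lambda>\<omega>. restrict \<omega> {}) \<in> PF.lim \<rightarrow>\<^sub>M PiM {} (\<lambda>_. count_space UNIV)"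
      by (simp add: restrict_def space_PiM measurable_const)
    show "prob_space (distr PF.lim (PiM {} (\<lambda>_. count_space UNIV)) (\<lambda>\<omega>. restrict \<omega> {}))"
      unfolding distr_lim[OF finite.emptyI] by (rule PF.prob_space_P) simp_all
  qed
qed

lemma srw_law_cylinder:
  assumes "\<And>i. i < n \<Longrightarrow> finite (neighbours E (v i)) \<and> neighbours E (v i) \<noteq> {}"
  shows "measure (srw_law E x) {\<omega>. \<forall>i\<le>n. \<omega> i = v i} =
    (if v 0 = x \<and> (\<forall>i<n. {v i, v (Suc i)} \<in> E)
     then \<Prod>i<n. 1 / real (card (neighbours E (v i))) else 0)"
proof -
  have "measure (srw_law E x) {\<omega>. \<forall>i\<le>n. \<omega> i = v i} =
      indicat_real {x} (v 0) * (\<Prod>i<n. pmf (pmf_of_set (neighbours E (v i))) (v (Suc i)))"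
    unfolding measure_def srw_law_emeasure_cylinder by (simp add: prod_nonneg)
  also have "(\<Prod>i<n. pmf (pmf_of_set (neighbours E (v i))) (v (Suc i))) =
      (\<Prod>i<n. indicat_real (neighbours E (v i)) (v (Suc i)) / real (card (neighbours E (v i))))"
    using assms by (intro prod.cong refl) simp
  also have "indicat_real {x} (v 0) * \<dots> =
      (if v 0 = x \<and> (\<forall>i<n. {v i, v (Suc i)} \<in> E)
       then \<Prod>i<n. 1 / real (card (neighbours E (v i))) else 0)"
    by (auto simp: neighbours_def indicator_def)
  finally show ?thesis .
qed


section \<open>Finite triple collision property\<close>

text \<open>The joint law of three independent walks is the product of their laws.\<close>

definition finite_triple_collision_property :: "'v set \<Rightarrow> 'v set set \<Rightarrow> bool" where
  "finite_triple_collision_property V E \<longleftrightarrow>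
     (\<exists>x\<in>V. AE (X1, X2, X3) in srw_law E x \<Otimes>\<^sub>M srw_law E x \<Otimes>\<^sub>M srw_law E x.
        finite {n. X1 n = X2 n \<and> X2 n = X3 n})"


section \<open>Comb graphs\<close>

definition comb_verts :: "(int \<Rightarrow> real) \<Rightarrow> (int \<times> nat) set" where
  "comb_verts H = {(x, l). real l \<le> H x}"

definition comb_edges :: "(int \<Rightarrow> real) \<Rightarrow> (int \<times> nat) set set" where
  "comb_edges H =
     {{(x, 0), (y, 0)} | x y. \<bar>x - y\<bar> = 1} \<union>
     {{(x, l), (x, k)} | x l k.
        (x, l) \<in> comb_verts H \<and> (x, k) \<in> comb_verts H \<and> \<bar>int l - int k\<bar> = 1}"

lemma comb_edge_iff:
  "{(x, l), (y, k)} \<in> comb_edges H \<longleftrightarrow>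
     l = 0 \<and> k = 0 \<and> \<bar>x - y\<bar> = 1 \<or>
     x = y \<and> real l \<le> H x \<and> real k \<le> H x \<and> \<bar>int l - int k\<bar> = 1"
  (is "?e \<in> _ \<longleftrightarrow> ?spine \<or> ?tooth")
proof -
  have iff: "?e \<in> comb_edges H \<longleftrightarrow>
      (\<exists>x' y'. ?e = {(x', 0), (y', 0)} \<and> \<bar>x' - y'\<bar> = 1) \<or>
      (\<exists>x' l' k'. ?e = {(x', l'), (x', k')} \<and>
        (x', l') \<in> comb_verts H \<and> (x', k') \<in> comb_verts H \<and> \<bar>int l' - int k'\<bar> = 1)"
    by (simp only: comb_edges_def Un_iff mem_Collect_eq)
  show ?thesis
  proof
    assume "?e \<in> comb_edges H"
    then show "?spine \<or> ?tooth"
      unfolding iff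
    proof (elim disjE exE conjE)
      fix x' y' assume "?e = {(x', 0), (y', 0)}" "\<bar>x' - y'\<bar> = 1"
      then show ?thesis by (auto simp: doubleton_eq_iff)
    next
      fix x' l' k'
      assume "?e = {(x', l'), (x', k')}" "(x', l') \<in> comb_verts H" "(x', k') \<in> comb_verts H"
        "\<bar>int l' - int k'\<bar> = 1"
      then show ?thesis by (auto simp: doubleton_eq_iff comb_verts_def)
    qed
  next
    assume "?spine \<or> ?tooth"
    then show "?e \<in> comb_edges H"
    proof
      assume ?spine
      then show ?thesis
        unfolding iff by - (rule disjI1, rule exI[of _ x], rule exI[of _ y], simp)
    next
      assume ?tooth
      then show ?thesis
        unfolding iff
        by - (rule disjI2, rule exI[of _ x], rule exI[of _ l], rule exI[of _ k],
            auto simp: comb_verts_def)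
    qed
  qed
qed

lemma neighbours_comb_nonempty:
  assumes "v \<in> comb_verts H" shows "neighbours (comb_edges H) v \<noteq> {}"
proof (cases v)
  case (Pair x l)
  have "(if l = 0 then (x + 1, 0) else (x, l - 1)) \<in> neighbours (comb_edges H) v"
    using assms Pair by (simp add: neighbours_def comb_edge_iff comb_verts_def)
  then show ?thesis
    by (metis empty_iff)
qed

lemma connected_locally_finite_comb:
  assumes "\<And>x. 0 \<le> H x"
  shows "connected_locally_finite_graph (comb_verts H) (comb_edges H)"
proof -
  let ?R = "{(a, b). {a, b} \<in> comb_edges H}"
  have sym: "sym (?R\<^sup>*)"
    by (rule sym_rtrancl) (auto simp: sym_def insert_commute)
  have tooth: "((x, l), (x, 0)) \<in> ?R\<^sup>*" if "real l \<le> H x" for x l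
    using that
  proof (induction l)
    case (Suc l)
    have "((x, Suc l), (x, l)) \<in> ?R"
      using Suc.prems by (auto simp: comb_edge_iff)
    with Suc show ?case
      by (auto intro: converse_rtrancl_into_rtrancl)
  qed simp
  have right: "((x, 0), (x + int n, 0)) \<in> ?R\<^sup>*" for x n
  proof (induction n)
    case (Suc n)
    have "((x + int n, 0), (x + int (Suc n), 0)) \<in> ?R"
      by (auto simp: comb_edge_iff)
    with Suc show ?case
      by (auto intro: rtrancl_into_rtrancl)
  qed simp
  have spine: "((x, 0), (y, 0)) \<in> ?R\<^sup>*" for x y
    using right[of x "nat (y - x)"] right[of y "nat (x - y)", THEN symD[OF sym]]
    by (cases "x \<le> y") auto
  have "((x, l), (y, k)) \<in> ?R\<^sup>*" if "real l \<le> H x" "real k \<le> H y" for x l y k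
    using rtrancl_trans[OF rtrancl_trans[OF tooth[OF that(1)] spine]
        symD[OF sym tooth[OF that(2)]]] .
  moreover have "finite (neighbours (comb_edges H) v)" for v
  proof (cases v)
    case (Pair x l)
    have "neighbours (comb_edges H) v \<subseteq> {x - 1..x + 1} \<times> {..Suc l}"
      using Pair by (auto simp: neighbours_def comb_edge_iff)
    then show ?thesis
      by (rule finite_subset) simp
  qed
  moreover have "comb_verts H \<noteq> {}"
    using assms[of 0] by (auto simp: comb_verts_def intro!: exI[of _ 0])
  moreover have "\<exists>u\<in>comb_verts H. \<exists>v\<in>comb_verts H. u \<noteq> v \<and> e = {u, v}" if "e \<in> comb_edges H" for e
  proof -
    have "(\<exists>x y. e = {(x, 0), (y, 0)} \<and> \<bar>x - y\<bar> = 1) \<or>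
        (\<exists>x l k. e = {(x, l), (x, k)} \<and>
          (x, l) \<in> comb_verts H \<and> (x, k) \<in> comb_verts H \<and> \<bar>int l - int k\<bar> = 1)"
      using that by (simp only: comb_edges_def Un_iff mem_Collect_eq)
    then show ?thesis
    proof (elim disjE exE conjE)
      fix x y assume "e = {(x, 0), (y, 0)}" "\<bar>x - y\<bar> = 1"
      then show ?thesis
        using assms
        by (intro bexI[of _ "(x, 0)"] bexI[of _ "(y, 0)"]) (simp_all add: comb_verts_def, auto)
    next
      fix x l k
      assume "e = {(x, l), (x, k)}" "(x, l) \<in> comb_verts H" "(x, k) \<in> comb_verts H"
        "\<bar>int l - int k\<bar> = 1"
      then show ?thesis
        by (intro bexI[of _ "(x, l)"] bexI[of _ "(x, k)"]) auto
    qed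
  qed
  ultimately show ?thesis
    unfolding connected_locally_finite_graph_def by (simp add: comb_verts_def split_paired_all)
qed

end

theory Submission
  imports Defs "HOL-Real_Asymp.Real_Asymp"
begin

text \<open>At time \<open>N\<close> the walk has spread over about \<open>sqrt (N / log N)\<close> teeth carrying about
  \<open>sqrt (N log N)\<close> vertices, so its transition probabilities are of order \<open>1 / sqrt (N log N)\<close> and
  the expected number of triple collisions in \<open>{N..2 N}\<close> is of order \<open>1 / log N\<close>. Summed over
  dyadic \<open>N\<close> this diverges logarithmically, so a first moment bound does not suffice. However, three
  walks meeting at height \<open>h\<close> in a tooth behave like walks on the integers up to time \<open>h\<^sup>2\<close> and
  are expected to collide of order \<open>log h\<close> further times. The probability of a collision at height
  at least \<open>2 ^ s\<close> is therefore smaller than the expected number by a factor \<open>s\<close>, while lower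
  vertices carry little of the mass. With \<open>s\<close> a small power of \<open>log N\<close> the collision probabilities
  of the dyadic blocks become summable. The heat kernel bounds come from volume and resistance
  estimates, which hold almost surely at all large scales by Hoeffding's inequality.\<close>

section \<open>Markov chains with a discrete kernel\<close>

text \<open>The scale comes from weighing volume against resistance. Cut off at height r, a tooth
  has on average of order log r vertices, so r = sqrt(2^k / k) neighbouring teeth hold about r k =
  sqrt(2^k k) vertices within resistance of order r, and volume times resistance is the time 2^k.
  This balance fails for vertices higher than r. There only the bound 2^(-k/2), valid at every
  vertex of the comb, is available; combined with the good bound at the origin it gives 2^(-k/2)
  k^(-1/4), and a block expects k^(-1/2) collisions instead of 1/k. The loss is affordable because
  clusters above height 2^(k/4) have size of order k, which leaves k^(-3/2). Between heights 2^(k^a)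
  and 2^(k/4) the bound 1/k gains a cluster factor k^a. Below, there is no cluster gain, but about
  2^(k/2) k^(2a) vertices carry mass at most of order k^(2a - 1/2), and the walk leaves the window
  in which they are counted with probability of order k^(-2a). Every range is summable as soon as 0
  < a < 1/4; the choice is a = 1/8.\<close>

primrec chain :: "('s \<Rightarrow> 's pmf) \<Rightarrow> nat \<Rightarrow> 's \<Rightarrow> 's pmf" where
  "chain K 0 u = return_pmf u"
| "chain K (Suc n) u = bind_pmf (K u) (chain K n)"

primrec path_pmf :: "('s \<Rightarrow> 's pmf) \<Rightarrow> nat \<Rightarrow> 's \<Rightarrow> 's list pmf" where
  "path_pmf K 0 u = return_pmf [u]"
| "path_pmf K (Suc n) u = map_pmf ((#) u) (bind_pmf (K u) (path_pmf K n))"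

text \<open>First-step recursion for the probability of meeting \<open>D\<close> by time
  \<open>j\<close>. Stopping on entry lets plain induction on \<open>j\<close> do the work of the
  strong Markov property.\<close>

primrec hit :: "('s \<Rightarrow> 's pmf) \<Rightarrow> 's set \<Rightarrow> nat \<Rightarrow> 's \<Rightarrow> ennreal" where
  "hit K D 0 u = indicator D u"
| "hit K D (Suc j) u = (if u \<in> D then 1 else \<integral>\<^sup>+w. hit K D j w \<partial>measure_pmf (K u))"

lemma chain_add: "chain K (m + n) u = bind_pmf (chain K m u) (chain K n)"
  by (induction m arbitrary: u) (auto simp: bind_return_pmf bind_assoc_pmf intro!: bind_pmf_cong)

lemma set_chain_subset:
  assumes "\<And>u. u \<in> S \<Longrightarrow> set_pmf (K u) \<subseteq> S" "u \<in> S"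
  shows "set_pmf (chain K n u) \<subseteq> S"
  using assms(2) by (induction n arbitrary: u) (use assms(1) in fastforce)+

lemma finite_set_chain:
  assumes "\<And>u. u \<in> S \<Longrightarrow> set_pmf (K u) \<subseteq> S" "\<And>u. u \<in> S \<Longrightarrow> finite (set_pmf (K u))" "u \<in> S"
  shows "finite (set_pmf (chain K n u))"
  using assms(3)
proof (induction n arbitrary: u)
  case (Suc n)
  have "finite (set_pmf (chain K n w))" if "w \<in> set_pmf (K u)" for w
    using Suc.IH Suc.prems assms(1) that by blast
  then show ?case using Suc.prems assms(2) by auto
qed simp

lemma length_path_pmf: "l \<in> set_pmf (path_pmf K n u) \<Longrightarrow> length l = Suc n"
  by (induction n arbitrary: u l) auto

text \<open>The list is written through a sequence \<open>v\<close> so that the right-hand side has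
  the same form as \<open>srw_law_emeasure_cylinder\<close>; this is how the two path laws are
  compared.\<close>

lemma pmf_path_pmf:
  "pmf (path_pmf K n u) (map v [0..<Suc n]) =
     indicat_real {u} (v 0) * (\<Prod>i<n. pmf (K (v i)) (v (Suc i)))"
proof (induction n arbitrary: u v)
  case 0
  show ?case by (simp add: indicator_def)
next
  case (Suc n)
  let ?l = "map (\<lambda>i. v (Suc i)) [0..<Suc n]"
  have l: "map v [0..<Suc (Suc n)] = v 0 # ?l"
    by (simp only: upt_conv_Cons[OF zero_less_Suc] map_Suc_upt[symmetric] list.map map_map o_def)
  have "pmf (bind_pmf (K u) (path_pmf K n)) ?l =
      (\<integral>w. indicat_real {w} (v 1) * (\<Prod>i<n. pmf (K (v (Suc i))) (v (Suc (Suc i)))) \<partial>measure_pmf (K u))"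
    unfolding pmf_bind Suc by simp
  also have "\<dots> = (\<Prod>i<n. pmf (K (v (Suc i))) (v (Suc (Suc i)))) * pmf (K u) (v 1)"
    by (subst integral_measure_pmf_real[where A = "{v 1}"]) (auto simp: indicator_def)
  finally have eq: "pmf (bind_pmf (K u) (path_pmf K n)) ?l =
      (\<Prod>i<n. pmf (K (v (Suc i))) (v (Suc (Suc i)))) * pmf (K u) (v 1)" .
  show ?case
  proof (cases "v 0 = u")
    case True
    have "pmf (path_pmf K (Suc n) u) (u # ?l) = pmf (bind_pmf (K u) (path_pmf K n)) ?l"
      by (simp only: path_pmf.simps) (rule pmf_map_inj', simp)
    then show ?thesis
      unfolding l using True eq
      by (simp add: prod.lessThan_Suc_shift del: prod.lessThan_Suc path_pmf.simps upt_Suc)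
  next
    case False
    then have "v 0 # ?l \<notin> set_pmf (path_pmf K (Suc n) u)"
      by auto
    then show ?thesis
      unfolding l using False by (simp add: set_pmf_iff del: path_pmf.simps)
  qed
qed

lemma emeasure_path_pmf_hit0:
  "emeasure (path_pmf K j u) {l. \<exists>i\<le>j. l ! i \<in> D} = hit K D j u"
proof (induction j arbitrary: u)
  case 0
  then show ?case by (simp add: indicator_def)
next
  case (Suc j)
  have pre: "(#) u -` {l. \<exists>i\<le>Suc j. l ! i \<in> D} = (if u \<in> D then UNIV else {l. \<exists>i\<le>j. l ! i \<in> D})"
  proof -
    have "(\<exists>i\<le>Suc j. (u # l) ! i \<in> D) \<longleftrightarrow> u \<in> D \<or> (\<exists>i\<le>j. l ! i \<in> D)" for l
      by (subst ex_simps[symmetric]) (auto simp: nth_Cons' split: if_splits)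
    then show ?thesis by auto
  qed
  show ?case
    unfolding path_pmf.simps hit.simps emeasure_map_pmf pre by (simp add: Suc)
qed

text \<open>Markov property at the fixed time \<open>N\<close>: dropping the initial state shifts
  the time window by one.\<close>

lemma emeasure_path_pmf_hit:
  "emeasure (path_pmf K (N + j) u) {l. \<exists>i\<in>{N..N + j}. l ! i \<in> D} =
     (\<integral>\<^sup>+w. hit K D j w \<partial>measure_pmf (chain K N u))"
proof (induction N arbitrary: u)
  case 0
  show ?case using emeasure_path_pmf_hit0[of K j u D] by (simp add: Bex_def)
next
  case (Suc N)
  have pre: "(#) u -` {l. \<exists>i\<in>{Suc N..Suc (N + j)}. l ! i \<in> D} = {l. \<exists>i\<in>{N..N + j}. l ! i \<in> D}"
    by (auto simp flip: image_Suc_atLeastAtMost)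
  show ?case
    unfolding add_Suc path_pmf.simps chain.simps emeasure_map_pmf pre by (simp add: Suc)
qed

text \<open>Cluster estimate. Once \<open>D\<close> is entered, at least \<open>\<kappa>\<close>
  visits to \<open>B\<close> are expected within the next \<open>m\<close> steps, and earlier visits
  are simply discarded. The two sets differ because a cluster that begins in \<open>D\<close> need
  not stay there.\<close>

lemma hit_le_visits:
  assumes S: "\<And>u. u \<in> S \<Longrightarrow> set_pmf (K u) \<subseteq> S"
    and \<kappa>: "\<And>u. u \<in> S \<inter> D \<Longrightarrow> \<kappa> \<le> (\<Sum>i\<le>m. emeasure (chain K i u) B)"
    and u: "u \<in> S"
  shows "\<kappa> * hit K D j u \<le> (\<Sum>i\<le>j + m. emeasure (chain K i u) B)"
  using u
proof (induction j arbitrary: u)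
  case 0
  then show ?case using \<kappa>[of u] by (auto simp: indicator_def)
next
  case (Suc j)
  show ?case
  proof (cases "u \<in> D")
    case True
    then have "\<kappa> * hit K D (Suc j) u \<le> (\<Sum>i\<le>m. emeasure (chain K i u) B)"
      using \<kappa>[of u] Suc.prems by simp
    also have "\<dots> \<le> (\<Sum>i\<le>Suc j + m. emeasure (chain K i u) B)"
      by (rule sum_mono2) auto
    finally show ?thesis .
  next
    case False
    have "\<kappa> * hit K D (Suc j) u = (\<integral>\<^sup>+w. \<kappa> * hit K D j w \<partial>measure_pmf (K u))"
      using False by (simp add: nn_integral_cmult)
    also have "\<dots> \<le> (\<integral>\<^sup>+w. (\<Sum>i\<le>j + m. emeasure (chain K i w) B) \<partial>measure_pmf (K u))"
      using Suc.IH S[OF Suc.prems] by (intro nn_integral_mono_AE) (auto simp: AE_measure_pmf_iff)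
    also have "\<dots> = (\<Sum>i\<le>j + m. emeasure (chain K (Suc i) u) B)"
      by (simp add: nn_integral_sum)
    also have "\<dots> \<le> emeasure (chain K 0 u) B + (\<Sum>i\<le>j + m. emeasure (chain K (Suc i) u) B)"
      by simp
    also have "\<dots> = (\<Sum>i\<le>Suc j + m. emeasure (chain K i u) B)"
      using sum.atMost_Suc_shift[of "\<lambda>i. emeasure (chain K i u) B" "j + m"] by simp
    finally show ?thesis .
  qed
qed

lemma path_hit_le_visits:
  assumes S: "\<And>u. u \<in> S \<Longrightarrow> set_pmf (K u) \<subseteq> S"
    and \<kappa>: "\<And>u. u \<in> S \<inter> D \<Longrightarrow> \<kappa> \<le> (\<Sum>i\<le>m. emeasure (chain K i u) B)"
    and u: "u \<in> S"
  shows "\<kappa> * emeasure (path_pmf K (N + j) u) {l. \<exists>i\<in>{N..N + j}. l ! i \<in> D} \<le>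
     (\<Sum>i\<le>j + m. emeasure (chain K (N + i) u) B)"
proof -
  have "\<kappa> * emeasure (path_pmf K (N + j) u) {l. \<exists>i\<in>{N..N + j}. l ! i \<in> D} =
      (\<integral>\<^sup>+w. \<kappa> * hit K D j w \<partial>measure_pmf (chain K N u))"
    unfolding emeasure_path_pmf_hit by (simp add: nn_integral_cmult)
  also have "\<dots> \<le> (\<integral>\<^sup>+w. (\<Sum>i\<le>j + m. emeasure (chain K i w) B) \<partial>measure_pmf (chain K N u))"
    using set_chain_subset[of S K u N] S u
    by (intro nn_integral_mono_AE) (auto simp: AE_measure_pmf_iff intro!: hit_le_visits[OF S \<kappa>])
  also have "\<dots> = (\<Sum>i\<le>j + m. emeasure (chain K (N + i) u) B)"
    by (simp add: nn_integral_sum chain_add)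
  finally show ?thesis .
qed


section \<open>Three independent copies of a chain\<close>

definition triple_kernel :: "('s \<Rightarrow> 's pmf) \<Rightarrow> 's \<times> 's \<times> 's \<Rightarrow> ('s \<times> 's \<times> 's) pmf" where
  "triple_kernel K = (\<lambda>(a, b, c). pair_pmf (K a) (pair_pmf (K b) (K c)))"

lemma bind_pair_pmf_pair:
  "bind_pmf (pair_pmf A B) (\<lambda>(x, y). pair_pmf (f x) (g y)) = pair_pmf (bind_pmf A f) (bind_pmf B g)"
  unfolding pair_pmf_def bind_assoc_pmf bind_return_pmf case_prod_conv
  by (intro bind_pmf_cong refl bind_commute_pmf)

lemma chain_triple_kernel:
  "chain (triple_kernel K) n (a, b, c) =
     pair_pmf (chain K n a) (pair_pmf (chain K n b) (chain K n c))"
proof (induction n arbitrary: a b c)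
  case (Suc n)
  have "chain (triple_kernel K) n = (\<lambda>(a, y). pair_pmf (chain K n a)
      ((\<lambda>(b, c). pair_pmf (chain K n b) (chain K n c)) y))"
    using Suc by (auto simp: fun_eq_iff)
  then show ?case
    by (simp add: triple_kernel_def bind_pair_pmf_pair)
qed simp

definition diag3 :: "'s set \<Rightarrow> ('s \<times> 's \<times> 's) set" where
  "diag3 B = (\<lambda>v. (v, v, v)) ` B"

lemma emeasure_chain_diag3:
  assumes "finite B"
  shows "emeasure (chain (triple_kernel K) n (a, a, a)) (diag3 B) =
    ennreal (\<Sum>v\<in>B. pmf (chain K n a) v ^ 3)"
proof -
  have "inj_on (\<lambda>v. (v, v, v)) B" by (auto simp: inj_on_def)
  then show ?thesis
    unfolding chain_triple_kernel diag3_def using assms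
    by (simp add: emeasure_measure_pmf_finite sum.reindex pmf_pair power3_eq_cube mult.assoc)
qed

text \<open>Lets \<open>B\<close> be infinite, for instance the whole vertex type: with
  \<open>F\<close> the finite support at time \<open>n\<close>, the event reduces to a finite sum of
  cubes.\<close>

lemma emeasure_chain_diag3_cut:
  assumes "set_pmf (chain K n a) \<subseteq> F"
  shows "emeasure (chain (triple_kernel K) n (a, a, a)) (diag3 B) =
    emeasure (chain (triple_kernel K) n (a, a, a)) (diag3 (B \<inter> F))"
  using assms by (intro emeasure_eq_AE) (auto simp: AE_measure_pmf_iff diag3_def chain_triple_kernel)


section \<open>The law of three simple random walks\<close>

definition srw_step :: "'v set set \<Rightarrow> 'v \<Rightarrow> 'v pmf" where
  "srw_step E v = pmf_of_set (neighbours E v)"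

definition srw3 :: "'v set set \<Rightarrow> 'v \<Rightarrow> ((nat \<Rightarrow> 'v) \<times> (nat \<Rightarrow> 'v) \<times> (nat \<Rightarrow> 'v)) measure" where
  "srw3 E x = srw_law E x \<Otimes>\<^sub>M srw_law E x \<Otimes>\<^sub>M srw_law E x"

lemma prob_space_srw3: "prob_space (srw3 E x)"
proof -
  interpret A: prob_space "srw_law E x" by (rule prob_space_srw_law)
  interpret B: pair_prob_space "srw_law E x" "srw_law E x" ..
  interpret C: pair_prob_space "srw_law E x" "srw_law E x \<Otimes>\<^sub>M srw_law E x" ..
  show ?thesis unfolding srw3_def by unfold_locales
qed

definition prefix3 :: "nat \<Rightarrow> (nat \<Rightarrow> 'v) \<times> (nat \<Rightarrow> 'v) \<times> (nat \<Rightarrow> 'v) \<Rightarrow> ('v \<times> 'v \<times> 'v) list" where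
  "prefix3 n = (\<lambda>(a, b, c). map (\<lambda>i. (a i, b i, c i)) [0..<Suc n])"

lemma cylinder_sets:
  fixes v :: "nat \<Rightarrow> 'v"
  shows "{\<omega>. \<forall>i\<le>n. \<omega> i = v i} \<in> sets (srw_law E x)"
proof -
  have "{\<omega>. \<forall>i\<le>n. \<omega> i = v i} =
      (\<Inter>i\<in>{..n}. (\<lambda>\<omega>. \<omega> i) -` {v i} \<inter> space (PiM UNIV (\<lambda>_. count_space UNIV)))"
    by (auto simp: space_PiM)
  also have "\<dots> \<in> sets (PiM UNIV (\<lambda>_. count_space UNIV))"
    by (intro sets.finite_INT measurable_sets[OF measurable_component_singleton]) auto
  finally show ?thesis by (simp add: sets_srw_law)
qed

lemma prefix3_vimage:
  "prefix3 n -` {map (\<lambda>i. (a i, b i, c i)) [0..<Suc n]} =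
     {\<omega>. \<forall>i\<le>n. \<omega> i = a i} \<times> {\<omega>. \<forall>i\<le>n. \<omega> i = b i} \<times> {\<omega>. \<forall>i\<le>n. \<omega> i = c i}"
  by (auto simp: prefix3_def less_Suc_eq_le simp del: upt_Suc)

lemma list3_cases:
  fixes l :: "('v \<times> 'v \<times> 'v) list"
  assumes "length l = Suc n"
  obtains a b c where "l = map (\<lambda>i. (a i, b i, c i)) [0..<Suc n]"
proof
  show "l = map (\<lambda>i. (fst (l ! i), fst (snd (l ! i)), snd (snd (l ! i)))) [0..<Suc n]"
    using assms by (intro nth_equalityI) (auto simp del: upt_Suc)
qed

lemma prefix3_vimage_sets:
  fixes x :: "'v"
  shows "prefix3 n -` {l} \<in> sets (srw3 E x)"
proof (cases "length l = Suc n")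
  case True
  then obtain a b c where "l = map (\<lambda>i. (a i, b i, c i)) [0..<Suc n]" by (rule list3_cases)
  then show ?thesis
    unfolding srw3_def by (auto simp only: prefix3_vimage intro!: pair_measureI cylinder_sets)
next
  case False
  then have "prefix3 n -` {l} = {}" by (auto simp: prefix3_def)
  then show ?thesis by simp
qed

lemma space_srw3 [simp]: "space (srw3 E x) = UNIV"
  by (simp add: srw3_def space_pair_measure)

lemma measurable_prefix3 [measurable]:
  fixes x :: "'v :: countable"
  shows "prefix3 n \<in> srw3 E x \<rightarrow>\<^sub>M count_space UNIV"
  by (subst measurable_count_space_eq2_countable) (auto simp: prefix3_vimage_sets)

text \<open>Countability of the vertex type reduces the claim to singletons, where both sides are
  products of three cylinder probabilities. Kernel and \<open>srw_step\<close> use the same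
  \<open>pmf_of_set\<close>, so even its unspecified values agree and \<open>E\<close> may be
  arbitrary.\<close>

lemma distr_prefix3:
  fixes x :: "'v :: countable"
  shows "distr (srw3 E x) (count_space UNIV) (prefix3 n) =
    measure_pmf (path_pmf (triple_kernel (srw_step E)) n (x, x, x))"
proof (rule measure_eqI_countable)
  fix l :: "('v \<times> 'v \<times> 'v) list"
  interpret A: prob_space "srw_law E x" by (rule prob_space_srw_law)
  interpret B: pair_prob_space "srw_law E x" "srw_law E x" ..
  have eq: "emeasure (distr (srw3 E x) (count_space UNIV) (prefix3 n)) {l} =
      emeasure (srw3 E x) (prefix3 n -` {l})"
    by (simp add: emeasure_distr)
  show "emeasure (distr (srw3 E x) (count_space UNIV) (prefix3 n)) {l} =
      emeasure (measure_pmf (path_pmf (triple_kernel (srw_step E)) n (x, x, x))) {l}"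
  proof (cases "length l = Suc n")
    case True
    then obtain a b c where l: "l = map (\<lambda>i. (a i, b i, c i)) [0..<Suc n]" by (rule list3_cases)
    have "emeasure (srw3 E x) (prefix3 n -` {l}) =
        emeasure (srw_law E x) {\<omega>. \<forall>i\<le>n. \<omega> i = a i} *
        (emeasure (srw_law E x) {\<omega>. \<forall>i\<le>n. \<omega> i = b i} * emeasure (srw_law E x) {\<omega>. \<forall>i\<le>n. \<omega> i = c i})"
      unfolding l prefix3_vimage srw3_def
      by (simp add: B.P.emeasure_pair_measure_Times A.emeasure_pair_measure_Times pair_measureI cylinder_sets)
    also have "\<dots> = ennreal (pmf (path_pmf (triple_kernel (srw_step E)) n (x, x, x)) l)"
      unfolding srw_law_emeasure_cylinder l pmf_path_pmf
      by (simp add: triple_kernel_def srw_step_def pmf_pair prod.distrib ennreal_mult[symmetric] prod_nonneg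
          mult_nonneg_nonneg) (auto simp: indicator_def)
    finally show ?thesis unfolding eq by (simp add: emeasure_pmf_single)
  next
    case False
    then have "prefix3 n -` {l} = {}" by (auto simp: prefix3_def)
    moreover have "l \<notin> set_pmf (path_pmf (triple_kernel (srw_step E)) n (x, x, x))"
      using False by (auto dest: length_path_pmf)
    ultimately show ?thesis unfolding eq by (simp add: emeasure_pmf_single set_pmf_iff)
  qed
qed auto

text \<open>The event depends on finitely many coordinates, so measurability and probability both
  come from the discrete path law; from here on no trajectory space is needed until
  Borel-Cantelli.\<close>

lemma triple_collision_event_sets:
  fixes x :: "'v :: countable"
  shows "{(X1, X2, X3). \<exists>n\<in>{N..N + j}. X1 n = X2 n \<and> X2 n = X3 n \<and> X1 n \<in> D} \<in> sets (srw3 E x)"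
    and "emeasure (srw3 E x) {(X1, X2, X3). \<exists>n\<in>{N..N + j}. X1 n = X2 n \<and> X2 n = X3 n \<and> X1 n \<in> D} =
      emeasure (path_pmf (triple_kernel (srw_step E)) (N + j) (x, x, x))
        {l. \<exists>i\<in>{N..N + j}. l ! i \<in> diag3 D}"
proof -
  let ?A = "{(X1, X2, X3). \<exists>n\<in>{N..N + j}. X1 n = X2 n \<and> X2 n = X3 n \<and> X1 n \<in> D}"
  have A: "?A = prefix3 (N + j) -` {l. \<exists>i\<in>{N..N + j}. l ! i \<in> diag3 D} \<inter> space (srw3 E x)"
    by (auto simp: prefix3_def diag3_def simp del: upt_Suc intro!: bexI)
  show "?A \<in> sets (srw3 E x)"
    unfolding A by measurable
  show "emeasure (srw3 E x) ?A = emeasure (path_pmf (triple_kernel (srw_step E)) (N + j) (x, x, x))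
        {l. \<exists>i\<in>{N..N + j}. l ! i \<in> diag3 D}"
    unfolding distr_prefix3[symmetric] A by (subst emeasure_distr) auto
qed

section \<open>Heat kernel bounds on a locally finite graph\<close>

text \<open>\<open>V\<close> is closed under neighbours, so a walk started in \<open>V\<close> never
  meets an unspecified value of \<open>pmf_of_set\<close>. Connectedness enters later through
  explicit paths.\<close>

locale srw_graph =
  fixes E :: "'v :: countable set set" and V :: "'v set"
  assumes neighbours_subset: "v \<in> V \<Longrightarrow> neighbours E v \<subseteq> V"
    and finite_neighbours: "v \<in> V \<Longrightarrow> finite (neighbours E v)"
    and neighbours_nonempty: "v \<in> V \<Longrightarrow> neighbours E v \<noteq> {}"
begin

abbreviation "nb \<equiv> neighbours E"

definition deg :: "'v \<Rightarrow> real" where "deg v = real (card (nb v))"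

definition p :: "nat \<Rightarrow> 'v \<Rightarrow> 'v \<Rightarrow> real" where
  "p n u v = pmf (chain (srw_step E) n u) v"

text \<open>Heat kernel density with respect to the reversible measure \<open>deg\<close>; in
  contrast to \<open>p\<close> it is symmetric.\<close>

definition q :: "nat \<Rightarrow> 'v \<Rightarrow> 'v \<Rightarrow> real" where
  "q n u v = p n u v / deg v"

abbreviation "supp n u \<equiv> set_pmf (chain (srw_step E) n u)"

section \<open>Reversibility of the walk\<close>

lemma nb_sym: "w \<in> nb v \<longleftrightarrow> v \<in> nb w"
  by (simp add: neighbours_def insert_commute)

lemma nb_in_V: "v \<in> V \<Longrightarrow> w \<in> nb v \<Longrightarrow> w \<in> V"
  using neighbours_subset by blast

lemma deg_ge_1: "v \<in> V \<Longrightarrow> 1 \<le> deg v"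
  using finite_neighbours[of v] neighbours_nonempty[of v] card_gt_0_iff[of "nb v"]
  by (simp add: deg_def Suc_le_eq)

lemma set_srw_step: "v \<in> V \<Longrightarrow> set_pmf (srw_step E v) = nb v"
  by (simp add: srw_step_def finite_neighbours neighbours_nonempty)

lemma pmf_srw_step: "v \<in> V \<Longrightarrow> pmf (srw_step E v) w = indicator (nb v) w / deg v"
  by (simp add: srw_step_def finite_neighbours neighbours_nonempty deg_def)

lemma supp_subset: "u \<in> V \<Longrightarrow> supp n u \<subseteq> V"
  by (rule set_chain_subset) (auto simp: set_srw_step nb_in_V)

lemma finite_supp: "u \<in> V \<Longrightarrow> finite (supp n u)"
  by (rule finite_set_chain[where S = V]) (auto simp: set_srw_step nb_in_V finite_neighbours)

lemma p_nonneg [simp]: "0 \<le> p n u v"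
  by (simp add: p_def)

lemma q_nonneg [simp]: "0 \<le> q n u v"
  by (simp add: q_def deg_def)

lemma p_eq_deg_q: "v \<in> V \<Longrightarrow> p n u v = deg v * q n u v"
  using deg_ge_1[of v] by (simp add: q_def)

lemma p_eq_0: "v \<notin> supp n u \<Longrightarrow> p n u v = 0"
  by (simp add: p_def set_pmf_iff)

lemma q_eq_0: "v \<notin> supp n u \<Longrightarrow> q n u v = 0"
  by (simp add: q_def p_eq_0)

lemma p_0: "p 0 u v = of_bool (u = v)"
  by (simp add: p_def indicator_def)

lemma p_Suc: "u \<in> V \<Longrightarrow> p (Suc n) u v = (\<Sum>w\<in>nb u. p n w v) / deg u"
  by (simp add: p_def pmf_bind srw_step_def integral_pmf_of_set neighbours_nonempty
      finite_neighbours deg_def)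

lemma sum_p_le_1: "finite F \<Longrightarrow> (\<Sum>v\<in>F. p n u v) \<le> 1"
  by (simp add: p_def measure_measure_pmf_finite[symmetric])

lemma sum_p_eq_1: "finite F \<Longrightarrow> supp n u \<subseteq> F \<Longrightarrow> (\<Sum>v\<in>F. p n u v) = 1"
  by (simp add: p_def sum_pmf_eq_1)

lemma q_0: "q 0 u v = of_bool (u = v) / deg v"
  by (simp add: q_def p_0)

lemma q_Suc_left: "u \<in> V \<Longrightarrow> q (Suc n) u v = (\<Sum>w\<in>nb u. q n w v) / deg u"
  by (simp add: q_def p_Suc sum_divide_distrib mult.commute)

text \<open>Splitting off the last step gives the same recursion as splitting off the initial one,
  because edges are unordered. Comparison with \<open>q_Suc_left\<close> yields symmetry.\<close>

lemma q_Suc_right: "u \<in> V \<Longrightarrow> v \<in> V \<Longrightarrow> q (Suc n) u v = (\<Sum>w\<in>nb v. q n u w) / deg v"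
proof (induction n arbitrary: u)
  case 0
  have "(\<Sum>w\<in>nb u. q 0 w v) = (if v \<in> nb u then 1 / deg v else 0)"
    using finite_neighbours[OF 0(1)] by (simp add: q_0 of_bool_def if_distrib[of "\<lambda>x. x / _"] cong: if_cong)
  moreover have "(\<Sum>w\<in>nb v. q 0 u w) = (if u \<in> nb v then 1 / deg u else 0)"
    using finite_neighbours[OF 0(2)] by (simp add: q_0 of_bool_def if_distrib[of "\<lambda>x. x / _"] cong: if_cong)
  ultimately show ?case
    using 0 nb_sym[of u v] by (simp add: q_Suc_left)
next
  case (Suc n)
  have "q (Suc (Suc n)) u v = (\<Sum>z\<in>nb u. \<Sum>w\<in>nb v. q n z w / deg v) / deg u"
    using Suc by (simp add: q_Suc_left[of u] nb_in_V sum_divide_distrib[symmetric] Suc.IH)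
  also have "\<dots> = (\<Sum>w\<in>nb v. \<Sum>z\<in>nb u. q n z w / deg u) / deg v"
    by (subst sum.swap) (simp add: sum_divide_distrib mult.commute)
  also have "\<dots> = (\<Sum>w\<in>nb v. q (Suc n) u w) / deg v"
    using Suc.prems by (simp add: q_Suc_left sum_divide_distrib)
  finally show ?case .
qed

lemma q_sym: "u \<in> V \<Longrightarrow> v \<in> V \<Longrightarrow> q n u v = q n v u"
proof (induction n arbitrary: u)
  case 0
  then show ?case by (simp add: q_0)
next
  case (Suc n)
  then show ?case
    by (simp add: q_Suc_left[of u] q_Suc_right[of v u] nb_in_V)
qed

lemma q_add:
  assumes "u \<in> V" "v \<in> V" "finite F" "supp n u \<subseteq> F" "F \<subseteq> V"
  shows "q (n + m) u v = (\<Sum>w\<in>F. deg w * q n u w * q m v w)"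
proof -
  have "p (n + m) u v = (\<Sum>w\<in>F. p m w v * p n u w)"
    unfolding p_def chain_add pmf_bind
    by (rule integral_measure_pmf_real) (use assms in auto)
  also have "\<dots> = (\<Sum>w\<in>F. deg v * (deg w * q n u w * q m v w))"
    using assms by (intro sum.cong) (auto simp: p_eq_deg_q q_sym[of _ v] subset_iff)
  finally have "deg v * q (n + m) u v = deg v * (\<Sum>w\<in>F. deg w * q n u w * q m v w)"
    using assms by (simp add: p_eq_deg_q sum_distrib_left)
  then show ?thesis using deg_ge_1[OF assms(2)] by simp
qed

text \<open>Cauchy-Schwarz in the space weighted by \<open>deg\<close>, applied to the
  Chapman-Kolmogorov sum. The two end points enter separately, so on-diagonal bounds of different
  quality can be combined.\<close>

lemma q_off_diagonal:
  assumes "u \<in> V" "v \<in> V"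
  shows "(q (a + b) u v)\<^sup>2 \<le> q (2 * a) u u * q (2 * b) v v"
proof -
  let ?F = "supp a u \<union> supp b v"
  have F: "finite ?F" "?F \<subseteq> V" using assms finite_supp supp_subset by auto
  have "(q (a + b) u v)\<^sup>2 = (\<Sum>w\<in>?F. (sqrt (deg w) * q a u w) * (sqrt (deg w) * q b v w))\<^sup>2"
    using F assms by (subst q_add[of u v ?F]) (auto simp: deg_def intro!: arg_cong[where f = "\<lambda>x. x\<^sup>2"] sum.cong)
  also have "\<dots> \<le> (\<Sum>w\<in>?F. (sqrt (deg w) * q a u w)\<^sup>2) * (\<Sum>w\<in>?F. (sqrt (deg w) * q b v w)\<^sup>2)"
    by (rule Cauchy_Schwarz_ineq_sum)
  also have "(\<Sum>w\<in>?F. (sqrt (deg w) * q a u w)\<^sup>2) = q (a + a) u u"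
    using F assms by (subst q_add[of u u ?F]) (auto simp: deg_def power2_eq_square intro!: sum.cong)
  also have "(\<Sum>w\<in>?F. (sqrt (deg w) * q b v w)\<^sup>2) = q (b + b) v v"
    using F assms by (subst q_add[of v v ?F]) (auto simp: deg_def power2_eq_square intro!: sum.cong)
  finally show ?thesis by (simp add: mult_2)
qed

text \<open>Adding two consecutive times removes the parity obstruction of bipartite graphs.\<close>

definition psi :: "nat \<Rightarrow> 'v \<Rightarrow> real" where
  "psi n u = q (2 * n) u u + q (Suc (2 * n)) u u"

section \<open>Dirichlet energy, effective resistance and on-diagonal bounds\<close>

definition energy :: "('v \<Rightarrow> real) \<Rightarrow> 'v set \<Rightarrow> real" where
  "energy f F = (\<Sum>v\<in>F. \<Sum>w\<in>nb v \<inter> F. (f v - f w)\<^sup>2) / 2"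

lemma energy_nonneg: "0 \<le> energy f F"
  by (simp add: energy_def sum_nonneg)

lemma psi_nonneg: "0 \<le> psi n u"
  by (simp add: psi_def)

text \<open>Discrete summation by parts: exchanging \<open>v\<close> and \<open>w\<close>
  symmetrises the sum. There are no boundary terms since all neighbours of the support of
  \<open>f\<close> lie in \<open>F\<close>.\<close>

lemma dirichlet_form_eq_energy:
  assumes F: "finite F" "F \<subseteq> V" and supp: "\<And>v. f v \<noteq> 0 \<Longrightarrow> v \<in> F \<Longrightarrow> nb v \<subseteq> F"
  shows "(\<Sum>v\<in>F. \<Sum>w\<in>nb v. f v * (f v - f w)) = energy f F"
proof -
  let ?S = "\<Sum>v\<in>F. \<Sum>w\<in>nb v \<inter> F. f v * (f v - f w)"
  have "?S = (\<Sum>v\<in>F. \<Sum>w\<in>F. if w \<in> nb v then f v * (f v - f w) else 0)"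
    by (rule sum.cong[OF refl]) (simp add: sum.inter_restrict[OF F(1)] Int_commute)
  also have "\<dots> = (\<Sum>w\<in>F. \<Sum>v\<in>F. if w \<in> nb v then f v * (f v - f w) else 0)"
    by (rule sum.swap)
  also have "\<dots> = (\<Sum>v\<in>F. \<Sum>w\<in>F. if w \<in> nb v then f w * (f w - f v) else 0)"
    by (intro sum.cong refl) (simp add: nb_sym)
  also have "\<dots> = (\<Sum>v\<in>F. \<Sum>w\<in>nb v \<inter> F. f w * (f w - f v))"
    by (rule sum.cong[OF refl]) (simp add: sum.inter_restrict[OF F(1)] Int_commute)
  finally have "?S + ?S = (\<Sum>v\<in>F. \<Sum>w\<in>nb v \<inter> F. f v * (f v - f w) + f w * (f w - f v))"
    by (simp add: sum.distrib)
  also have "\<dots> = 2 * energy f F"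
    by (simp add: energy_def power2_eq_square algebra_simps)
  finally have "?S = energy f F" by simp
  moreover have "(\<Sum>v\<in>F. \<Sum>w\<in>nb v. f v * (f v - f w)) = ?S"
  proof (rule sum.cong[OF refl])
    fix v assume "v \<in> F"
    then show "(\<Sum>w\<in>nb v. f v * (f v - f w)) = (\<Sum>w\<in>nb v \<inter> F. f v * (f v - f w))"
      using supp[of v] by (cases "f v = 0") (auto simp: Int_absorb2)
  qed
  ultimately show ?thesis by simp
qed

text \<open>For f = q_m + q_(m+1) the generator telescopes: f minus its neighbour average is q_m -
  q_(m+2). Pairing this with f gives four return densities, at times 2m, 2m+1, 2m+2 and 2m+3, which
  are exactly the two values of \<open>psi\<close>. Three supports are needed because neighbours of
  the support of f are reached by time m+2.\<close>

lemma energy_heat_kernel: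
  assumes u: "u \<in> V" and F: "finite F" "F \<subseteq> V"
    and supp: "supp m u \<subseteq> F" "supp (Suc m) u \<subseteq> F" "supp (Suc (Suc m)) u \<subseteq> F"
  shows "energy (\<lambda>v. q m u v + q (Suc m) u v) F = psi m u - psi (Suc m) u"
proof -
  let ?f = "\<lambda>v. q m u v + q (Suc m) u v"
  have nbF: "nb v \<subseteq> F" if "?f v \<noteq> 0" "v \<in> F" for v
  proof
    fix w assume w: "w \<in> nb v"
    have vV: "v \<in> V" using that F by auto
    have wV: "w \<in> V" using w vV nb_in_V by blast
    have "q (Suc k) u w \<noteq> 0" if "q k u v \<noteq> 0" for k
    proof -
      have "0 < (\<Sum>z\<in>nb w. q k u z)"
        using that w by (intro sum_pos2[of _ v]) (auto simp: finite_neighbours[OF wV] nb_sym less_le)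
      then show ?thesis using deg_ge_1[OF wV] by (simp add: q_Suc_right[OF u wV])
    qed
    moreover have "q m u v \<noteq> 0 \<or> q (Suc m) u v \<noteq> 0"
      using that(1) by auto
    ultimately have "w \<in> supp (Suc m) u \<or> w \<in> supp (Suc (Suc m)) u"
      using q_eq_0 by blast
    then show "w \<in> F" using supp by blast
  qed
  have "energy ?f F = (\<Sum>v\<in>F. \<Sum>w\<in>nb v. ?f v * (?f v - ?f w))"
    using F nbF by (intro dirichlet_form_eq_energy[symmetric])
        (auto simp del: chain.simps)
  also have "\<dots> = (\<Sum>v\<in>F. deg v * ?f v * (q m u v - q (Suc (Suc m)) u v))"
  proof (rule sum.cong[OF refl])
    fix v assume "v \<in> F"
    then have v: "v \<in> V" using F by auto
    have s: "(\<Sum>w\<in>nb v. q k u w) = deg v * q (Suc k) u v" for k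
      using deg_ge_1[OF v] by (simp add: q_Suc_right[OF u v])
    have "(\<Sum>w\<in>nb v. ?f v * (?f v - ?f w)) =
        ?f v * (deg v * ?f v - ((\<Sum>w\<in>nb v. q m u w) + (\<Sum>w\<in>nb v. q (Suc m) u w)))"
      by (simp add: sum_distrib_left[symmetric] sum_subtractf sum.distrib deg_def)
    then show "(\<Sum>w\<in>nb v. ?f v * (?f v - ?f w)) = deg v * ?f v * (q m u v - q (Suc (Suc m)) u v)"
      unfolding s by (simp add: algebra_simps)
  qed
  also have "\<dots> = (\<Sum>v\<in>F. deg v * q m u v * q m u v) + (\<Sum>v\<in>F. deg v * q (Suc m) u v * q m u v)
      - (\<Sum>v\<in>F. deg v * q m u v * q (Suc (Suc m)) u v) - (\<Sum>v\<in>F. deg v * q (Suc m) u v * q (Suc (Suc m)) u v)"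
    by (simp add: sum.distrib[symmetric] sum_subtractf[symmetric] algebra_simps)
  also have "\<dots> = q (m + m) u u + q (Suc m + m) u u - q (m + Suc (Suc m)) u u - q (Suc m + Suc (Suc m)) u u"
    using u F supp by (simp only: q_add[of u u F, symmetric])
  also have "\<dots> = psi m u - psi (Suc m) u"
    by (simp add: psi_def mult_2)
  finally show ?thesis .
qed

lemma psi_decreasing:
  assumes u: "u \<in> V" and mn: "m \<le> n"
  shows "psi n u \<le> psi m u"
  using mn
proof (induction n rule: dec_induct)
  case (step n)
  have "0 \<le> psi n u - psi (Suc n) u"
    using energy_nonneg u finite_supp supp_subset
    by (subst energy_heat_kernel[of u "supp n u \<union> supp (Suc n) u \<union> supp (Suc (Suc n)) u", symmetric])
        (auto simp del: chain.simps)
  with step show ?case by simp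
qed simp

lemma q_le_psi:
  assumes "u \<in> V" "v \<in> V" "m \<le> n div 2"
  shows "q n u v \<le> sqrt (psi m u * psi m v)"
proof -
  have ev: "q (2 * i) w w \<le> psi m w" if "w \<in> V" "m \<le> i" for w i
    using psi_decreasing[OF that] q_nonneg[of "Suc (2 * i)" w w] unfolding psi_def by linarith
  have "(q (n div 2 + (n - n div 2)) u v)\<^sup>2 \<le> q (2 * (n div 2)) u u * q (2 * (n - n div 2)) v v"
    by (rule q_off_diagonal[OF assms(1,2)])
  also have "\<dots> \<le> psi m u * psi m v"
    using assms by (intro mult_mono ev) (auto simp: psi_nonneg)
  finally show ?thesis
    by (simp add: real_le_rsqrt)
qed

text \<open>Effective resistance in its dual form: energy bounds a squared potential difference.
  \<open>F\<^sub>0\<close> holds the finitely many vertices that make the bound work, and every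
  larger finite \<open>F\<close> is allowed so that the supports of the heat kernel can be added.
  All energies stay finite sums.\<close>

definition resistance_le :: "'v \<Rightarrow> 'v \<Rightarrow> real \<Rightarrow> bool" where
  "resistance_le u w \<rho> \<longleftrightarrow> (\<exists>F\<^sub>0. finite F\<^sub>0 \<and> F\<^sub>0 \<subseteq> V \<and>
     (\<forall>F f. finite F \<longrightarrow> F \<subseteq> V \<longrightarrow> F\<^sub>0 \<subseteq> F \<longrightarrow> (f u - f w)\<^sup>2 \<le> \<rho> * energy f F))"

lemma resistance_le_mono:
  assumes "resistance_le u w \<rho>" "\<rho> \<le> \<rho>'"
  shows "resistance_le u w \<rho>'"
  using assms unfolding resistance_le_def
  by (meson energy_nonneg mult_right_mono order_trans)

text \<open>The factor 2 comes from (a + b)^2 <= 2 a^2 + 2 b^2, a cheap substitute for the exact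
  triangle inequality that only costs constants.\<close>

lemma resistance_le_trans:
  assumes "resistance_le u v a" "resistance_le v w b"
  shows "resistance_le u w (2 * (a + b))"
proof -
  obtain F\<^sub>0 F\<^sub>1 where F: "finite F\<^sub>0" "F\<^sub>0 \<subseteq> V" "finite F\<^sub>1" "F\<^sub>1 \<subseteq> V"
    and 0: "\<And>F f. finite F \<Longrightarrow> F \<subseteq> V \<Longrightarrow> F\<^sub>0 \<subseteq> F \<Longrightarrow> (f u - f v)\<^sup>2 \<le> a * energy f F"
    and 1: "\<And>F f. finite F \<Longrightarrow> F \<subseteq> V \<Longrightarrow> F\<^sub>1 \<subseteq> F \<Longrightarrow> (f v - f w)\<^sup>2 \<le> b * energy f F"
    using assms unfolding resistance_le_def by metis
  have "(f u - f w)\<^sup>2 \<le> 2 * (a + b) * energy f F" if "finite F" "F \<subseteq> V" "F\<^sub>0 \<union> F\<^sub>1 \<subseteq> F" for F f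
  proof -
    have "(f u - f w)\<^sup>2 \<le> 2 * (f u - f v)\<^sup>2 + 2 * (f v - f w)\<^sup>2"
      using zero_le_power2[of "(f u - f v) - (f v - f w)"] by (simp add: power2_eq_square algebra_simps)
    also have "\<dots> \<le> 2 * (a * energy f F) + 2 * (b * energy f F)"
      using 0[of F f] 1[of F f] that by auto
    finally show ?thesis by (simp add: algebra_simps)
  qed
  then show ?thesis
    unfolding resistance_le_def using F by (intro exI[of _ "F\<^sub>0 \<union> F\<^sub>1"]) auto
qed

text \<open>Cauchy-Schwarz along the path. Injectivity ensures that each edge is used once; its two
  orientations \<open>?A\<close> and \<open>?B\<close> account for the factor 2 in
  \<open>2 * energy f F\<close>.\<close>

lemma resistance_le_path:
  fixes \<gamma> :: "nat \<Rightarrow> 'v"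
  assumes inj: "inj_on \<gamma> {..L}" and V: "\<And>i. i \<le> L \<Longrightarrow> \<gamma> i \<in> V"
    and adj: "\<And>i. i < L \<Longrightarrow> \<gamma> (Suc i) \<in> nb (\<gamma> i)"
  shows "resistance_le (\<gamma> 0) (\<gamma> L) (real L)"
proof -
  have "(f (\<gamma> 0) - f (\<gamma> L))\<^sup>2 \<le> real L * energy f F"
    if F: "finite F" "F \<subseteq> V" "\<gamma> ` {..L} \<subseteq> F" for F f
  proof -
    let ?d = "\<lambda>(v, w). (f v - f w)\<^sup>2"
    let ?A = "(\<lambda>i. (\<gamma> i, \<gamma> (Suc i))) ` {..<L}" and ?B = "(\<lambda>i. (\<gamma> (Suc i), \<gamma> i)) ` {..<L}"
    have iff: "\<gamma> i = \<gamma> j \<longleftrightarrow> i = j" if "i \<le> L" "j \<le> L" for i j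
      using inj that by (auto simp: inj_on_def)
    have injA: "inj_on (\<lambda>i. (\<gamma> i, \<gamma> (Suc i))) {..<L}" and injB: "inj_on (\<lambda>i. (\<gamma> (Suc i), \<gamma> i)) {..<L}"
      by (auto simp: inj_on_def iff)
    have disj: "?A \<inter> ?B = {}" by (auto simp: iff)
    have "f (\<gamma> 0) - f (\<gamma> k) = (\<Sum>i<k. f (\<gamma> i) - f (\<gamma> (Suc i)))" for k
      by (induction k) auto
    then have "(f (\<gamma> 0) - f (\<gamma> L))\<^sup>2 \<le> (\<Sum>i<L. (f (\<gamma> i) - f (\<gamma> (Suc i)))\<^sup>2) * real L"
      using sum_squared_le_sum_of_squares[of "\<lambda>i. f (\<gamma> i) - f (\<gamma> (Suc i))" "{..<L}"] by simp
    moreover have "2 * (\<Sum>i<L. (f (\<gamma> i) - f (\<gamma> (Suc i)))\<^sup>2) = sum ?d ?A + sum ?d ?B"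
      by (simp add: sum.reindex[OF injA] sum.reindex[OF injB] power2_commute)
    moreover have "sum ?d ?A + sum ?d ?B = sum ?d (?A \<union> ?B)"
      using disj by (simp add: sum.union_disjoint)
    moreover have "sum ?d (?A \<union> ?B) \<le> sum ?d (SIGMA v:F. nb v \<inter> F)"
      using F adj by (intro sum_mono2) (auto simp: finite_SigmaI nb_sym image_subset_iff)
    moreover have "sum ?d (SIGMA v:F. nb v \<inter> F) = 2 * energy f F"
      using F by (simp add: energy_def sum.Sigma)
    ultimately show ?thesis
      by (smt (verit) mult.commute mult_left_mono of_nat_0_le_iff)
  qed
  then show ?thesis
    unfolding resistance_le_def using V by (intro exI[of _ "\<gamma> ` {..L}"]) auto
qed

text \<open>The averaging argument of Barlow, Coulhon and Kumagai: on a set \<open>B\<close> the heat kernel is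
  somewhere at most \<open>2 / card B\<close>, and its oscillation on \<open>B\<close> is controlled by the energy, which is
  the discrete time derivative of \<open>psi\<close>.\<close>

lemma psi_upper_bound:
  assumes u: "u \<in> V" and B: "finite B" "B \<subseteq> V" "B \<noteq> {}"
    and res: "\<And>w. w \<in> B \<Longrightarrow> resistance_le u w \<rho>" and \<rho>: "0 \<le> \<rho>" and n: "0 < n"
  shows "psi (2 * n) u \<le> 4 / real (card B) + \<rho> / real n"
proof -
  define t where "t = psi (2 * n) u"
  \<comment> \<open>Pigeonhole over \<open>n\<close> decrements whose sum is at most
    \<open>t\<close>. Time \<open>2 * j\<close> makes the value of \<open>?f\<close> at
    \<open>u\<close> equal to \<open>psi j u\<close>; \<open>n \<le> j\<close> lets the decrements
    start at \<open>t\<close>, and \<open>j < 2 * n\<close> gives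
    \<open>t \<le> psi j u\<close>.\<close>
  have "\<exists>j\<in>{n..<2 * n}. psi (2 * j) u - psi (Suc (2 * j)) u \<le> t / real n"
  proof (rule ccontr)
    assume "\<not> ?thesis"
    then have less: "t / real n < psi (2 * j) u - psi (Suc (2 * j)) u" if "j \<in> {n..<2 * n}" for j
      using that by force
    have tele: "(\<Sum>j\<in>{n..<n + k}. psi (2 * j) u - psi (Suc (2 * j)) u) \<le> psi (2 * n) u - psi (2 * (n + k)) u" for k
    proof (induction k)
      case (Suc k)
      have "psi (2 * (n + Suc k)) u \<le> psi (Suc (2 * (n + k))) u"
        by (rule psi_decreasing[OF u]) simp
      with Suc show ?case by simp
    qed simp
    have "t = (\<Sum>j\<in>{n..<n + n}. t / real n)" using n by simp
    also have "\<dots> < (\<Sum>j\<in>{n..<n + n}. psi (2 * j) u - psi (Suc (2 * j)) u)"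
      using n by (intro sum_strict_mono less) auto
    also have "\<dots> \<le> t"
      using tele[of n] psi_nonneg[of "2 * (n + n)" u] unfolding t_def by linarith
    finally show False by simp
  qed
  then obtain j where j: "n \<le> j" "j < 2 * n" "psi (2 * j) u - psi (Suc (2 * j)) u \<le> t / real n"
    by auto
  let ?f = "\<lambda>v. q (2 * j) u v + q (Suc (2 * j)) u v"
  \<comment> \<open>Since degrees are at least 1, \<open>?f\<close> sums over \<open>B\<close> to at
    most 2, one unit for each of the two times, so its minimum is at most the average.\<close>
  have "\<exists>w\<in>B. ?f w \<le> 2 / real (card B)"
  proof (rule ccontr)
    assume "\<not> ?thesis"
    then have less: "2 / real (card B) < ?f w" if "w \<in> B" for w using that by force
    have "2 = (\<Sum>w\<in>B. 2 / real (card B))" using B by simp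
    also have "\<dots> < (\<Sum>w\<in>B. ?f w)" using B by (intro sum_strict_mono less) auto
    also have "\<dots> \<le> (\<Sum>w\<in>B. p (2 * j) u w + p (Suc (2 * j)) u w)"
    proof (rule sum_mono)
      fix w assume "w \<in> B"
      then have w: "w \<in> V" using B by auto
      have "q k u w \<le> p k u w" for k
        using deg_ge_1[OF w] mult_right_mono[of 1 "deg w" "q k u w"] by (simp add: p_eq_deg_q[OF w])
      then show "?f w \<le> p (2 * j) u w + p (Suc (2 * j)) u w" by (simp add: add_mono)
    qed
    also have "\<dots> \<le> 1 + 1"
      unfolding sum.distrib using B by (intro add_mono sum_p_le_1)
    finally show False by simp
  qed
  then obtain w where w: "w \<in> B" "?f w \<le> 2 / real (card B)" by auto
  obtain F\<^sub>0 where F\<^sub>0: "finite F\<^sub>0" "F\<^sub>0 \<subseteq> V"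
    "\<And>F f. finite F \<Longrightarrow> F \<subseteq> V \<Longrightarrow> F\<^sub>0 \<subseteq> F \<Longrightarrow> (f u - f w)\<^sup>2 \<le> \<rho> * energy f F"
    using res[OF w(1)] unfolding resistance_le_def by metis
  let ?F = "F\<^sub>0 \<union> (supp (2 * j) u \<union> supp (Suc (2 * j)) u \<union> supp (Suc (Suc (2 * j))) u)"
  have F: "finite ?F" "?F \<subseteq> V"
    using F\<^sub>0 u finite_supp supp_subset by (auto simp del: chain.simps)
  have "(?f u - ?f w)\<^sup>2 \<le> \<rho> * energy ?f ?F"
    using F by (intro F\<^sub>0(3)) auto
  also have "energy ?f ?F = psi (2 * j) u - psi (Suc (2 * j)) u"
    using F by (intro energy_heat_kernel[OF u]) auto
  also have "\<rho> * (psi (2 * j) u - psi (Suc (2 * j)) u) \<le> \<rho> * (t / real n)"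
    using j \<rho> by (intro mult_left_mono)
  finally have "?f u - ?f w \<le> sqrt (\<rho> / real n * t)"
    by (intro real_le_rsqrt) (simp add: mult.commute)
  \<comment> \<open>The half of \<open>t\<close> produced here is absorbed on the left at the end,
    which doubles the other terms to 4 / card and \<open>\<rho>\<close> / n.\<close>
  also have "\<dots> \<le> (\<rho> / real n + t) / 2"
    using arith_geo_mean_sqrt[of "\<rho> / real n" t] \<rho> psi_nonneg[of "2 * n" u] by (simp add: t_def)
  finally have "?f u \<le> 2 / real (card B) + (\<rho> / real n + t) / 2"
    using w(2) by linarith
  moreover have "t \<le> ?f u"
    using psi_decreasing[OF u, of j "2 * n"] j by (simp add: t_def psi_def)
  ultimately show ?thesis unfolding t_def by (simp add: field_simps)
qed

section \<open>Tail bounds from one-step drift\<close>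

lemma expectation_drift:
  assumes drift: "\<And>u. u \<in> V \<Longrightarrow> (\<Sum>w\<in>nb u. f w) / deg u \<le> f u + a" and u: "u \<in> V"
  shows "measure_pmf.expectation (chain (srw_step E) n u) f \<le> f u + real n * a"
  using u
proof (induction n arbitrary: u)
  case (Suc n)
  have "measure_pmf.expectation (chain (srw_step E) (Suc n) u) f =
      (\<Sum>w\<in>nb u. pmf (srw_step E u) w *\<^sub>R measure_pmf.expectation (chain (srw_step E) n w) f)"
    unfolding chain.simps using Suc.prems
    by (intro pmf_expectation_bind finite_neighbours finite_supp) (auto simp: set_srw_step nb_in_V)
  also have "\<dots> \<le> (\<Sum>w\<in>nb u. (f w + real n * a) / deg u)"
    using Suc by (intro sum_mono)
      (auto simp: pmf_srw_step nb_in_V deg_def intro!: divide_right_mono)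
  also have "\<dots> = (\<Sum>w\<in>nb u. f w) / deg u + real n * a"
    using deg_ge_1[OF Suc.prems] by (simp add: sum_divide_distrib[symmetric] sum.distrib deg_def field_simps)
  also have "\<dots> \<le> f u + real (Suc n) * a"
    using drift[OF Suc.prems] by (simp add: algebra_simps)
  finally show ?case .
qed simp

text \<open>Markov's inequality for \<open>f\<close> at time \<open>n\<close>. With a squared
  distance for \<open>f\<close> and a drift of 1 this is the diffusive Chebyshev bound.\<close>

lemma tail_drift:
  assumes drift: "\<And>u. u \<in> V \<Longrightarrow> (\<Sum>w\<in>nb u. f w) / deg u \<le> f u + a" and u: "u \<in> V"
    and f: "\<And>v. 0 \<le> f v" and c: "0 < c" and A: "\<And>v. v \<in> A \<Longrightarrow> c \<le> f v"
  shows "(\<Sum>v\<in>supp n u \<inter> A. p n u v) \<le> (f u + real n * a) / c"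
proof -
  have "c * (\<Sum>v\<in>supp n u \<inter> A. p n u v) \<le> (\<Sum>v\<in>supp n u \<inter> A. f v * p n u v)"
    unfolding sum_distrib_left using A by (intro sum_mono mult_right_mono) auto
  also have "\<dots> \<le> (\<Sum>v\<in>supp n u. f v * p n u v)"
    using finite_supp[OF u] f by (intro sum_mono2) auto
  also have "\<dots> = measure_pmf.expectation (chain (srw_step E) n u) f"
    unfolding p_def using finite_supp[OF u] by (intro integral_measure_pmf_real[symmetric])
        (auto simp del: chain.simps)
  also have "\<dots> \<le> f u + real n * a"
    by (rule expectation_drift[OF drift u])
  finally show ?thesis using c by (simp add: field_simps)
qed

end

context srw_graph
begin

text \<open>The finite sets \<open>A i\<close> allow \<open>\<kappa>\<close> to be checked inside
  one tooth although \<open>B\<close> may be infinite. Taking \<open>\<kappa>\<close> = 1,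
  \<open>m\<close> = 0 and the singleton of \<open>v\<close> recovers the plain first moment
  bound.\<close>

lemma triple_collision_prob_le:
  assumes "x \<in> V" "0 \<le> \<kappa>"
    and \<kappa>: "\<And>v. v \<in> V \<inter> D \<Longrightarrow> \<exists>A. (\<forall>i. finite (A i) \<and> A i \<subseteq> B) \<and> \<kappa> \<le> (\<Sum>i\<le>m. \<Sum>w\<in>A i. p i v w ^ 3)"
  shows "\<kappa> * measure (srw3 E x) {(X1, X2, X3). \<exists>n\<in>{N..N + j}. X1 n = X2 n \<and> X2 n = X3 n \<and> X1 n \<in> D}
    \<le> (\<Sum>i\<le>j + m. \<Sum>v\<in>B \<inter> supp (N + i) x. p (N + i) x v ^ 3)"
proof -
  interpret srw3: prob_space "srw3 E x" by (rule prob_space_srw3)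
  let ?K = "triple_kernel (srw_step E)"
  let ?A = "{(X1, X2, X3). \<exists>n\<in>{N..N + j}. X1 n = X2 n \<and> X2 n = X3 n \<and> X1 n \<in> D}"
  have S: "set_pmf (?K u) \<subseteq> V \<times> V \<times> V" if "u \<in> V \<times> V \<times> V" for u
    using that by (auto simp: triple_kernel_def set_srw_step nb_in_V)
  have \<kappa>3: "ennreal \<kappa> \<le> (\<Sum>i\<le>m. emeasure (chain ?K i u) (diag3 B))" if u: "u \<in> V \<times> V \<times> V \<inter> diag3 D" for u
  proof -
    obtain v where v: "u = (v, v, v)" "v \<in> V \<inter> D" using u unfolding diag3_def by blast
    obtain A where A: "\<And>i. finite (A i)" "\<And>i. A i \<subseteq> B" "\<kappa> \<le> (\<Sum>i\<le>m. \<Sum>w\<in>A i. p i v w ^ 3)"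
      using \<kappa>[OF v(2)] by blast
    have "ennreal \<kappa> \<le> (\<Sum>i\<le>m. ennreal (\<Sum>w\<in>A i. p i v w ^ 3))"
      using A(3) by (simp add: sum_nonneg ennreal_leI)
    also have "\<dots> \<le> (\<Sum>i\<le>m. emeasure (chain ?K i u) (diag3 B))"
      unfolding v p_def using A(1,2)
      by (intro sum_mono) (auto simp: emeasure_chain_diag3[symmetric] diag3_def intro!: emeasure_mono)
    finally show ?thesis .
  qed
  have diag: "emeasure (chain ?K n (x, x, x)) (diag3 B) = ennreal (\<Sum>v\<in>B \<inter> supp n x. p n x v ^ 3)" for n
    unfolding p_def using finite_supp[OF assms(1)]
    by (subst emeasure_chain_diag3_cut[OF order_refl]) (rule emeasure_chain_diag3, simp)
  have "ennreal (\<kappa> * measure (srw3 E x) ?A) = ennreal \<kappa> * emeasure (srw3 E x) ?A"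
    using assms(2) by (simp add: srw3.emeasure_eq_measure ennreal_mult)
  also have "\<dots> \<le> (\<Sum>i\<le>j + m. emeasure (chain ?K (N + i) (x, x, x)) (diag3 B))"
    unfolding triple_collision_event_sets(2)
    by (rule path_hit_le_visits[OF S \<kappa>3]) (use assms in auto)
  also have "\<dots> = ennreal (\<Sum>i\<le>j + m. \<Sum>v\<in>B \<inter> supp (N + i) x. p (N + i) x v ^ 3)"
    unfolding diag by (simp add: sum_nonneg)
  finally show ?thesis
    by (subst (asm) ennreal_le_iff) (auto intro!: sum_nonneg)
qed

end

section \<open>Random walk on a comb\<close>

locale comb =
  fixes H :: "int \<Rightarrow> real"
  assumes H_nonneg: "0 \<le> H x"
begin

abbreviation "CV \<equiv> comb_verts H"
abbreviation "CE \<equiv> comb_edges H"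

lemma in_CV [simp]: "(x, l) \<in> CV \<longleftrightarrow> real l \<le> H x"
  by (simp add: comb_verts_def)

lemma neighbours_spine:
  "neighbours CE (x, 0) = {(x - 1, 0), (x + 1, 0)} \<union> (if 1 \<le> H x then {(x, Suc 0)} else {})"
  by (auto simp: neighbours_def comb_edge_iff H_nonneg)

lemma neighbours_tooth:
  "real (Suc l) \<le> H x \<Longrightarrow> neighbours CE (x, Suc l) =
     {(x, l)} \<union> (if real (Suc (Suc l)) \<le> H x then {(x, Suc (Suc l))} else {})"
  by (auto simp: neighbours_def comb_edge_iff)

lemma vertex_cases:
  assumes "v \<in> CV"
  obtains (spine) x where "v = (x, 0)" | (tooth) x l where "v = (x, Suc l)" "real (Suc l) \<le> H x"
  using assms by (cases v; cases "snd v") auto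

sublocale srw_graph CE CV
proof
  fix v assume v: "v \<in> CV"
  then show "neighbours CE v \<noteq> {}" by (rule neighbours_comb_nonempty)
  show "neighbours CE v \<subseteq> CV"
    using v by (cases rule: vertex_cases) (auto simp: neighbours_spine neighbours_tooth H_nonneg)
  show "finite (neighbours CE v)"
    using v by (cases rule: vertex_cases) (auto simp: neighbours_spine neighbours_tooth)
qed

lemma deg_le_3: "v \<in> CV \<Longrightarrow> deg v \<le> 3"
  by (cases rule: vertex_cases) (auto simp: deg_def neighbours_spine neighbours_tooth card_insert_if)

section \<open>Spread of the walk along the spine and inside a tooth\<close>

lemma drift_spine_coordinate:
  assumes "v \<in> CV"
  shows "(\<Sum>w\<in>nb v. (real_of_int (fst w))\<^sup>2) / deg v \<le> (real_of_int (fst v))\<^sup>2 + 1"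
  using assms
  by (cases rule: vertex_cases)
    (auto simp: deg_def neighbours_spine neighbours_tooth power2_eq_square field_simps)

text \<open>\<open>f\<close> is the squared distance to \<open>(x, l)\<close> inside the tooth,
  capped at its value at the base and constant outside. The cap makes leaving the tooth
  harmless.\<close>

lemma drift_tooth_distance:
  fixes x :: int and l :: nat
  defines "f \<equiv> \<lambda>(y, j). if y = x then min ((real l)\<^sup>2) ((real j - real l)\<^sup>2) else (real l)\<^sup>2"
  assumes xl: "real l \<le> H x" and v: "v \<in> CV"
  shows "(\<Sum>w\<in>nb v. f w) / deg v \<le> f v + 1"
  using v
proof (cases rule: vertex_cases)
  case (spine y)
  then show ?thesis
    by (auto simp: f_def deg_def neighbours_spine field_simps)
next
  case (tooth y j)
  show ?thesis
  proof (cases "y = x")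
    case False
    then show ?thesis using tooth by (auto simp: f_def deg_def neighbours_tooth field_simps)
  next
    case True
    let ?g = "\<lambda>a. min ((real l)\<^sup>2) (a\<^sup>2)"
    define a where "a = real (Suc j) - real l"
    have fv: "f v = ?g a" "f (x, j) = ?g (a - 1)" "f (x, Suc (Suc j)) = ?g (a + 1)"
      using tooth True by (simp_all add: f_def a_def algebra_simps)
    show ?thesis
    proof (cases "real (Suc (Suc j)) \<le> H x")
      case True
      have "?g (a - 1) + ?g (a + 1) \<le> 2 * (?g a + 1)"
        by (auto simp: min_def power2_eq_square algebra_simps)
      then show ?thesis
        using True \<open>y = x\<close> tooth fv by (simp add: deg_def neighbours_tooth field_simps)
    next
      case False
      \<comment> \<open>At the tip the only step goes down. The tip is at least as high as
        \<open>l\<close>, so this step points towards \<open>l\<close>, or away from it by 1 when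
        the tip is \<open>l\<close> itself.\<close>
      then have "l \<le> Suc j" using xl by linarith
      then have "0 \<le> a" by (simp add: a_def)
      then have "?g (a - 1) \<le> ?g a + 1"
        by (auto simp: min_def power2_eq_square algebra_simps)
      then show ?thesis
        using False \<open>y = x\<close> tooth fv by (simp add: deg_def neighbours_tooth)
    qed
  qed
qed

lemma supp_spine_coordinate: "v \<in> CV \<Longrightarrow> w \<in> supp n v \<Longrightarrow> \<bar>fst w - fst v\<bar> \<le> int n"
proof (induction n arbitrary: v)
  case (Suc n)
  then obtain u where u: "u \<in> nb v" "w \<in> supp n u" by (auto simp: set_srw_step)
  have "\<bar>fst u - fst v\<bar> \<le> 1"
    using Suc.prems(1) u(1)
    by (cases rule: vertex_cases) (auto simp: neighbours_spine neighbours_tooth split: if_splits)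
  moreover have "\<bar>fst w - fst u\<bar> \<le> int n"
    using Suc.IH u nb_in_V[OF Suc.prems(1)] by blast
  ultimately show ?case by simp
qed simp


subsection \<open>Heat kernel bounds\<close>

text \<open>An injective infinite path from any vertex, down its tooth and along the spine. It
  supplies both resistance bounds and sets of any prescribed size.\<close>

lemma resistance_down_and_right:
  assumes "real l \<le> H x"
  defines "\<gamma> \<equiv> \<lambda>i. if i \<le> l then (x, l - i) else (x + int (i - l), 0)"
  shows "resistance_le (x, l) (\<gamma> L) (real L)" "inj \<gamma>" "\<gamma> i \<in> CV"
proof -
  show inj: "inj \<gamma>" by (auto simp: \<gamma>_def inj_def split: if_splits)
  show CV: "\<gamma> i \<in> CV" for i using assms(1) H_nonneg by (auto simp: \<gamma>_def)
  have "resistance_le (\<gamma> 0) (\<gamma> L) (real L)"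
  proof (rule resistance_le_path)
    fix i assume "i < L"
    consider "Suc i \<le> l" | "l \<le> i" by linarith
    then show "\<gamma> (Suc i) \<in> nb (\<gamma> i)"
      using assms(1) by cases (auto simp: \<gamma>_def neighbours_def comb_edge_iff)
  qed (use inj CV in \<open>auto simp: inj_on_def inj_def\<close>)
  then show "resistance_le (x, l) (\<gamma> L) (real L)" by (simp add: \<gamma>_def)
qed

lemma resistance_up: "real j \<le> H y \<Longrightarrow> resistance_le (y, 0) (y, j) (real j)"
  using resistance_le_path[of "\<lambda>i. (y, i)" j]
  by (auto simp: inj_on_def neighbours_def comb_edge_iff)

text \<open>A path of \<open>L\<close> vertices has volume \<open>L\<close> and resistance at most
  \<open>L\<close>; with \<open>L\<close> near sqrt n this gives order n^(-1/2) at every vertex. It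
  is the fallback high up in long teeth.\<close>

lemma psi_le_any:
  assumes v: "v \<in> CV" and "0 < L" "0 < n"
  shows "psi (2 * n) v \<le> 4 / real L + real L / real n"
proof -
  obtain x l where [simp]: "v = (x, l)" by force
  let ?\<gamma> = "\<lambda>i. if i \<le> l then (x, l - i) else (x + int (i - l), 0)"
  have l: "real l \<le> H x" using v by simp
  have card: "card (?\<gamma> ` {..<L}) = L"
    using resistance_down_and_right(2)[OF l] by (subst card_image) (auto intro: inj_on_subset)
  have "psi (2 * n) v \<le> 4 / real (card (?\<gamma> ` {..<L})) + real L / real n"
  proof (rule psi_upper_bound[OF v])
    show "?\<gamma> ` {..<L} \<subseteq> CV" by (intro image_subsetI resistance_down_and_right(3)[OF l])
    fix w assume "w \<in> ?\<gamma> ` {..<L}"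
    then obtain i where "w = ?\<gamma> i" "i < L" unfolding image_iff by blast
    then show "resistance_le v w (real L)"
      using resistance_down_and_right(1)[OF l, of i] by (auto intro: resistance_le_mono)
  qed (use assms in auto)
  then show ?thesis unfolding card .
qed

definition box :: "int \<Rightarrow> nat \<Rightarrow> (int \<times> nat) set" where
  "box x r = {(y, j). x \<le> y \<and> y < x + int r \<and> j \<le> r \<and> real j \<le> H y}"

lemma finite_box: "finite (box x r)"
  by (rule finite_subset[of _ "{x..x + int r} \<times> {..r}"]) (auto simp: box_def)

text \<open>Cutting the teeth at height \<open>r\<close> keeps the resistance of order
  \<open>r\<close>. The path goes down, along the spine and up, each leg at most \<open>r\<close>;
  two uses of \<open>resistance_le_trans\<close> give 2 (2 (r + r) + r) = 10 r.\<close>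

lemma psi_le_box:
  assumes "real l \<le> H x" "l \<le> r" "0 < r" "0 < n"
  shows "psi (2 * n) (x, l) \<le> 4 / real (card (box x r)) + 10 * real r / real n"
proof (rule psi_upper_bound[OF _ finite_box])
  show "(x, l) \<in> CV" "box x r \<subseteq> CV" using assms by (auto simp: box_def)
  have "(x, 0) \<in> box x r" using assms H_nonneg by (auto simp: box_def)
  then show "box x r \<noteq> {}" by auto
  fix w assume "w \<in> box x r"
  then obtain y j where w: "w = (y, j)" "x \<le> y" "y < x + int r" "j \<le> r" "real j \<le> H y"
    by (auto simp: box_def)
  have "resistance_le (x, l) (x, 0) (real l)"
    using resistance_down_and_right(1)[OF assms(1), of l] by simp
  moreover have "resistance_le (x, 0) (y, 0) (real (nat (y - x)))"
    using resistance_down_and_right(1)[of 0 x "nat (y - x)"] w H_nonneg by (cases "y = x") auto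
  moreover have "resistance_le (y, 0) w (real j)"
    using resistance_up w by simp
  ultimately have "resistance_le (x, l) w (2 * (2 * (real l + real (nat (y - x))) + real j))"
    using resistance_le_trans by blast
  then show "resistance_le (x, l) w (10 * real r)"
    by (rule resistance_le_mono) (use w assms in \<open>simp add: of_nat_nat; linarith\<close>)
qed (use assms in auto)

lemma p_le_psi:
  assumes "u \<in> CV" "v \<in> CV" "m \<le> n div 2" "psi m u \<le> a" "psi m v \<le> b"
  shows "p n u v \<le> 3 * sqrt (a * b)"
proof -
  have "p n u v \<le> 3 * q n u v"
    using p_eq_deg_q[OF assms(2)] deg_le_3[OF assms(2)] by (simp add: mult_right_mono)
  also have "q n u v \<le> sqrt (psi m u * psi m v)"
    by (rule q_le_psi[OF assms(1-3)])
  also have "\<dots> \<le> sqrt (a * b)"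
    using assms psi_nonneg[of m u] psi_nonneg[of m v] by (intro real_sqrt_le_mono mult_mono) auto
  finally show ?thesis by simp
qed


subsection \<open>Triple collisions high up in a tooth come in clusters\<close>

text \<open>Up to time l^2 / 4 the walk stays within 2 sqrt m of its start with probability at least
  3/4, hence on at most 5 sqrt m vertices. By convexity the sum of cubes is at least (3/4)^3 / (5
  sqrt m)^2 = 27 / (1600 m).\<close>

lemma sum_cubes_ge:
  assumes xl: "real l \<le> H x" and m: "0 < m" "4 * m \<le> l\<^sup>2"
  defines "A \<equiv> supp m (x, l) \<inter> {(y, j). y = x \<and> j < 2 * l}"
  shows "27 / 1600 / real m \<le> (\<Sum>w\<in>A. p m (x, l) w ^ 3)"
proof -
  let ?v = "(x, l)"
  let ?f = "\<lambda>(y, j). if y = x then min ((real l)\<^sup>2) ((real j - real l)\<^sup>2) else (real l)\<^sup>2"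
  let ?far = "{w. 4 * real m \<le> ?f w}"
  let ?near = "supp m ?v - ?far"
  have v: "?v \<in> CV" using xl by simp
  have fin: "finite (supp m ?v)" by (rule finite_supp[OF v])
  have "(\<Sum>w\<in>supp m ?v \<inter> ?far. p m ?v w) \<le> (?f ?v + real m * 1) / (4 * real m)"
    by (rule tail_drift[OF drift_tooth_distance[OF xl] v]) (use m in auto)
  also have "\<dots> = 1 / 4" using m by simp
  finally have far: "(\<Sum>w\<in>supp m ?v \<inter> ?far. p m ?v w) \<le> 1 / 4" .
  have "(\<Sum>w\<in>supp m ?v. p m ?v w) = (\<Sum>w\<in>supp m ?v \<inter> ?far. p m ?v w) + (\<Sum>w\<in>?near. p m ?v w)"
    using fin by (rule sum.Int_Diff)
  then have near: "3 / 4 \<le> (\<Sum>w\<in>?near. p m ?v w)"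
    using far sum_p_eq_1[OF fin order_refl] by simp
  have m': "4 * real m \<le> (real l)\<^sup>2"
    using m(2) by (metis of_nat_le_iff of_nat_mult of_nat_numeral of_nat_power)
  define R where "R = 2 * sqrt (real m)"
  have R: "R\<^sup>2 = 4 * real m" "0 \<le> R" "2 \<le> R"
    using m by (auto simp: R_def power_mult_distrib)
  then have R_le: "R \<le> real l"
    using m' power2_le_imp_le[of R "real l"] by simp
  have near_sub: "?near \<subseteq> (\<lambda>i. (x, nat i)) ` {int l - \<lfloor>R\<rfloor>..int l + \<lfloor>R\<rfloor>}" and near_A: "?near \<subseteq> A"
  proof -
    \<comment> \<open>Off the tooth \<open>?f\<close> equals l^2, which is at least 4 m, so every
      such vertex already counts as far.\<close>
    have *: "y = x \<and> \<bar>real j - real l\<bar> < R" if "(y, j) \<in> ?near" for y j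
    proof -
      have "y = x \<and> (real j - real l)\<^sup>2 < R\<^sup>2"
        using that m' R(1) by (auto simp: min_def split: if_splits)
      then show ?thesis
        using power2_less_imp_less[of "\<bar>real j - real l\<bar>" R] R(2) by simp
    qed
    show "?near \<subseteq> (\<lambda>i. (x, nat i)) ` {int l - \<lfloor>R\<rfloor>..int l + \<lfloor>R\<rfloor>}"
    proof
      fix w assume w: "w \<in> ?near"
      obtain y j where yj: "w = (y, j)" by force
      have "y = x \<and> \<bar>real j - real l\<bar> < R" using w unfolding yj by (rule *)
      then show "w \<in> (\<lambda>i. (x, nat i)) ` {int l - \<lfloor>R\<rfloor>..int l + \<lfloor>R\<rfloor>}"
        unfolding yj by (intro image_eqI[of _ _ "int j"]) (simp_all, linarith+)
    qed
    show "?near \<subseteq> A"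
    proof
      fix w assume w: "w \<in> ?near"
      obtain y j where yj: "w = (y, j)" by force
      have "y = x \<and> \<bar>real j - real l\<bar> < R" using w unfolding yj by (rule *)
      then have "y = x" "j < 2 * l" using R_le by (simp_all, linarith)
      then show "w \<in> A" using DiffD1[OF w] unfolding yj A_def by simp
    qed
  qed
  have "card ?near \<le> card {int l - \<lfloor>R\<rfloor>..int l + \<lfloor>R\<rfloor>}"
    using card_mono[OF _ near_sub] card_image_le[of "{int l - \<lfloor>R\<rfloor>..int l + \<lfloor>R\<rfloor>}" "\<lambda>i. (x, nat i)"]
    by simp
  then have "real (card ?near) \<le> 2 * R + 1"
    using R(2) by simp linarith
  then have card: "real (card ?near) \<le> 5 / 2 * R" using R(3) by simp
  \<comment> \<open>The average weight: mass 3/4 spread over 5/2 * \<open>R\<close> vertices.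
    Tangency at this point loses nothing against Jensen's inequality.\<close>
  define t where "t = 3 / (10 * R)"
  have t: "0 < t" "t * R = 3 / 10" using R(3) by (auto simp: t_def)
  \<comment> \<open>tangent line of the cube at \<open>t\<close>\<close>
  have tangent: "3 * t\<^sup>2 * a - 2 * t ^ 3 \<le> a ^ 3" if "0 \<le> a" for a
  proof -
    have "a ^ 3 - (3 * t\<^sup>2 * a - 2 * t ^ 3) = (a - t)\<^sup>2 * (a + 2 * t)"
      by (simp add: power2_eq_square power3_eq_cube algebra_simps)
    also have "\<dots> \<ge> 0" using that t by simp
    finally show ?thesis by simp
  qed
  have "27 / 1600 / real m = 27 / 400 / R\<^sup>2" using R(1) by simp
  also have "\<dots> = t\<^sup>2 * (3 / 4)"
    by (simp add: t_def power2_eq_square)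
  also have "t\<^sup>2 * (3 / 4) = 3 * t\<^sup>2 * (3 / 4) - 2 * t\<^sup>2 * (5 / 2 * (t * R))" unfolding t(2) by simp
  also have "\<dots> = 3 * t\<^sup>2 * (3 / 4) - 2 * t ^ 3 * (5 / 2 * R)"
    by (simp add: power2_eq_square power3_eq_cube)
  also have "\<dots> \<le> 3 * t\<^sup>2 * (\<Sum>w\<in>?near. p m ?v w) - 2 * t ^ 3 * real (card ?near)"
    using near card t by (intro diff_mono mult_left_mono) auto
  also have "\<dots> = (\<Sum>w\<in>?near. 3 * t\<^sup>2 * p m ?v w - 2 * t ^ 3)"
    by (simp add: sum_subtractf sum_distrib_left)
  also have "\<dots> \<le> (\<Sum>w\<in>?near. p m ?v w ^ 3)"
    by (intro sum_mono tangent) simp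
  also have "\<dots> \<le> (\<Sum>w\<in>A. p m ?v w ^ 3)"
    using fin near_A by (intro sum_mono2) (auto simp: A_def)
  finally show ?thesis .
qed

text \<open>Summing 1/m up to 4^(s-1) gives a logarithm of order \<open>s\<close>. The horizon is
  the largest power of 4 with 4 m <= (2^s)^2, time 0 contributes 1, and 27/1600 > 1/60.\<close>

lemma cluster_size:
  assumes xl: "real l \<le> H x" and s: "0 < s" "2 ^ s \<le> l"
  shows "real s / 60 \<le> (\<Sum>m\<le>4 ^ (s - 1). \<Sum>w\<in>supp m (x, l) \<inter> {(y, j). y = x \<and> j < 2 * l}. p m (x, l) w ^ 3)"
proof -
  define M where "M = (4 ^ (s - 1) :: nat)"
  define S where "S m = (\<Sum>w\<in>supp m (x, l) \<inter> {(y, j). y = x \<and> j < 2 * l}. p m (x, l) w ^ 3)" for m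
  have "l > 0" using s(2) by (metis gr0I not_le zero_less_numeral zero_less_power)
  then have S0: "S 0 = 1" by (simp add: S_def p_0)
  have "4 * M = (2 ^ s)\<^sup>2"
    using s(1) unfolding M_def by (cases s) (simp_all add: power2_eq_square power_mult_distrib[symmetric])
  also have "\<dots> \<le> l\<^sup>2" using s(2) by (rule power_mono) simp
  finally have M: "4 * M \<le> l\<^sup>2" .
  have S_ge: "27 / 1600 / real m \<le> S m" if "m \<in> {1..M}" for m
  proof -
    have "4 * m \<le> l\<^sup>2" using that M by (meson atLeastAtMost_iff mult_le_mono2 order_trans)
    then show ?thesis unfolding S_def using that by (intro sum_cubes_ge[OF xl]) auto
  qed
  have "1 \<le> ln (4 :: real)"
    using ln_ge_iff[of 4 1] exp_le by simp
  then have "real (s - 1) * 1 \<le> real (s - 1) * ln 4"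
    by (rule mult_left_mono) simp
  also have "\<dots> = ln (real M)" unfolding M_def of_nat_power of_nat_numeral by (rule ln_realpow[symmetric])
  also have "\<dots> \<le> ln (real M + 1)"
    by (subst ln_le_cancel_iff) (simp_all add: M_def add_pos_pos)
  also have "\<dots> \<le> harm M" by (rule ln_le_harm)
  finally have harm: "real (s - 1) \<le> harm M" by simp
  have "real (s - 1) = real s - 1" using s(1) by (simp add: of_nat_diff)
  then have "real s / 60 \<le> 1 + 27 / 1600 * real (s - 1)" by (simp add: field_simps)
  also have "\<dots> \<le> 1 + 27 / 1600 * harm M" using harm by simp
  also have "\<dots> = S 0 + (\<Sum>m\<in>{1..M}. 27 / 1600 / real m)"
    unfolding S0 harm_def sum_distrib_left divide_inverse by (rule refl)
  also have "\<dots> \<le> S 0 + (\<Sum>m\<in>{1..M}. S m)"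
    by (intro add_left_mono sum_mono S_ge)
  also have "\<dots> = sum S (insert 0 {1..M})"
    by (rule sum.insert[symmetric]) auto
  also have "insert 0 {1..M} = {..M}" by auto
  finally show ?thesis unfolding S_def M_def .
qed

end

subsection \<open>Triple collisions on one dyadic time block\<close>

text \<open>At time \<open>2 ^ k\<close> the walk has diffused a distance of order \<open>rad k\<close> along the spine. Vertices
  below level \<open>2 ^ lvl k\<close> and within distance \<open>wid k\<close> of the origin are few, and collisions at or
  above that level come in clusters of size at least of order \<open>lvl k\<close>.\<close>

definition rad :: "nat \<Rightarrow> nat" where "rad k = nat \<lfloor>sqrt (2 ^ k / real k)\<rfloor>"

definition lvl :: "nat \<Rightarrow> nat" where "lvl k = nat \<lceil>real k powr (1 / 8)\<rceil>"

definition wid :: "nat \<Rightarrow> nat" where "wid k = lvl k * 2 ^ ((k + 1) div 2)"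

text \<open>Number of vertices expected, up to constants, in \<open>rad k\<close> neighbouring teeth
  of truncated mean size \<open>k\<close>; apart from rounding in \<open>rad\<close>, the product
  \<open>rad k * vol_scale k\<close> is the time 2^k.\<close>

definition vol_scale :: "nat \<Rightarrow> real" where "vol_scale k = sqrt (2 ^ k * real k)"

definition collisions :: "nat \<Rightarrow> nat \<Rightarrow> 'v set \<Rightarrow> ((nat \<Rightarrow> 'v) \<times> (nat \<Rightarrow> 'v) \<times> (nat \<Rightarrow> 'v)) set" where
  "collisions N j D = {(X1, X2, X3). \<exists>n\<in>{N..N + j}. X1 n = X2 n \<and> X2 n = X3 n \<and> X1 n \<in> D}"

text \<open>The condition on \<open>rad k\<close> keeps a cluster started below height 2^(k div 4),
  and hence confined below twice that height, in the range of the box estimate. The condition on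
  \<open>lvl k\<close> orders the two cuts and keeps cluster durations below 2^k.\<close>

definition large_index :: "nat \<Rightarrow> bool" where
  "large_index k \<longleftrightarrow> 8 \<le> k \<and> 2 * 2 ^ (k div 4) \<le> rad k \<and> lvl k \<le> k div 4"

lemma eventually_large_index: "eventually large_index sequentially"
proof -
  have "\<forall>\<^sub>F k in sequentially. 2 * 2 powr (real k / 4) + 1 \<le> sqrt (2 ^ k / real k)"
    by real_asymp
  moreover have "\<forall>\<^sub>F k in sequentially. real k powr (1 / 8) + 3 \<le> real k / 4"
    by real_asymp
  ultimately show ?thesis
    using eventually_ge_at_top[of 8]
  proof eventually_elim
    case (elim k)
    have "(2::real) ^ (k div 4) = 2 powr real (k div 4)" by (simp add: powr_realpow)
    also have "\<dots> \<le> 2 powr (real k / 4)" by (intro powr_mono) (use of_nat_div_le_of_nat[of k 4] in auto)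
    finally have "2 * 2 ^ (k div 4) \<le> rad k"
      using elim(1) unfolding rad_def by (simp add: le_nat_iff le_floor_iff)
    moreover have "lvl k \<le> k div 4"
      using elim(2) unfolding lvl_def by (simp add: nat_le_iff ceiling_le_iff)
    ultimately show ?case using elim(3) by (simp add: large_index_def)
  qed
qed

lemma rad_bounds:
  assumes "large_index k"
  shows "0 < rad k" "real (rad k) \<le> sqrt (2 ^ k / real k)"
  using assms unfolding large_index_def by (auto simp: rad_def intro: order.strict_trans2[of 0 "2 * 2 ^ (k div 4)"])

lemma lvl_ge: "real k powr (1 / 8) \<le> real (lvl k)"
  unfolding lvl_def by (simp add: real_nat_ceiling_ge)

lemma lvl_pos: "0 < k \<Longrightarrow> 0 < lvl k"
  using lvl_ge[of k] by (metis gr0I not_le of_nat_0 of_nat_0_less_iff powr_gt_zero less_numeral_extra(3))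

lemma two_power_lvl_le:
  assumes "large_index k" shows "2 ^ lvl k \<le> rad k"
proof -
  have "(2::nat) ^ lvl k \<le> 2 ^ (k div 4)"
    using assms by (intro power_increasing) (auto simp: large_index_def)
  moreover have "2 * 2 ^ (k div 4) \<le> rad k"
    using assms by (simp only: large_index_def)
  ultimately show ?thesis by linarith
qed

lemma two_power_quarter:
  assumes "2 \<le> k" shows "(2 :: 'a :: comm_semiring_1) ^ k = 4 * 2 ^ (k - 2)"
proof -
  have "(2 :: 'a) ^ k = 2 ^ (2 + (k - 2))" using assms by (simp only: le_add_diff_inverse)
  also have "\<dots> = 2\<^sup>2 * 2 ^ (k - 2)" by (rule power_add)
  finally show ?thesis by simp
qed

lemma four_power_le: "s \<le> k div 4 \<Longrightarrow> (4::nat) ^ (s - 1) \<le> 2 ^ k"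
proof -
  assume "s \<le> k div 4"
  then have "2 * (s - 1) \<le> k" by linarith
  then have "(2::nat) ^ (2 * (s - 1)) \<le> 2 ^ k" by (intro power_increasing) auto
  then show ?thesis by (simp add: power_mult)
qed

lemma wid_ge: "2 ^ k * (real (lvl k))\<^sup>2 \<le> (real (wid k))\<^sup>2"
proof -
  have "(2::real) ^ k \<le> 2 ^ (2 * ((k + 1) div 2))" by (intro power_increasing) auto
  then show ?thesis
    unfolding wid_def of_nat_mult power_mult_distrib of_nat_power of_nat_numeral power_mult[symmetric]
    by (subst mult.commute) (rule mult_left_mono, simp_all add: mult.commute)
qed

text \<open>4 / c is the volume term of \<open>psi_le_box\<close>; 40 = 10 * 4 is its resistance
  term at n = 2^(k-2).\<close>

definition heat_const :: "real \<Rightarrow> real" where "heat_const c = 4 / c + 40"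

context srw_graph
begin

lemma sum_cubes_le:
  assumes "finite S" "0 \<le> \<alpha>" "\<And>v. v \<in> S \<Longrightarrow> p n u v \<le> \<alpha>"
  shows "(\<Sum>v\<in>S. p n u v ^ 3) \<le> \<alpha>\<^sup>2 * (\<Sum>v\<in>S. p n u v)"
  unfolding sum_distrib_left power3_eq_cube power2_eq_square
  using assms by (intro sum_mono mult_right_mono mult_mono) auto

end

context comb
begin

abbreviation "orig \<equiv> (0::int, 0::nat)"

definition low_verts :: "nat \<Rightarrow> (int \<times> nat) set" where
  "low_verts k = {(y, l). \<bar>y\<bar> \<le> int (wid k) \<and> l < 2 ^ lvl k \<and> real l \<le> H y}"

lemma finite_low_verts: "finite (low_verts k)"
  by (rule finite_subset[of _ "{- int (wid k)..int (wid k)} \<times> {..<2 ^ lvl k}"]) (auto simp: low_verts_def)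

lemma orig_in_CV: "orig \<in> CV"
  using H_nonneg by simp

text \<open>The box hypothesis reaches to distance 4 * 2^k because the block ends before time 2 *
  2^k and a cluster adds at most 2^k further steps, so no relevant vertex lies farther out.\<close>

context
  fixes k :: nat and c :: real
  assumes large: "large_index k" and c: "0 < c"
    and good: "\<And>x. \<bar>x\<bar> \<le> 4 * 2 ^ k \<Longrightarrow> c * vol_scale k \<le> real (card (box x (rad k)))"
begin

abbreviation "K \<equiv> heat_const c"

lemma K_pos: "0 < K" using c by (simp add: heat_const_def add_pos_pos)

lemma k_ge_8: "8 \<le> k" using large by (simp add: large_index_def)

lemma vol_scale_pos: "0 < vol_scale k" using k_ge_8 by (simp add: vol_scale_def)

text \<open>The index is 2^(k-1); \<open>psi\<close> doubles it, so the bound serves transition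
  probabilities from time 2^k on.\<close>

lemma psi_le_low:
  assumes "\<bar>x\<bar> \<le> 4 * 2 ^ k" "l \<le> rad k" "real l \<le> H x"
  shows "psi (2 * 2 ^ (k - 2)) (x, l) \<le> K / vol_scale k"
proof -
  have k4: "(2::real) ^ k = 4 * 2 ^ (k - 2)"
    using k_ge_8 by (intro two_power_quarter) simp
  have "psi (2 * 2 ^ (k - 2)) (x, l) \<le> 4 / real (card (box x (rad k))) + 10 * real (rad k) / real (2 ^ (k - 2))"
    using assms rad_bounds(1)[OF large] by (intro psi_le_box) auto
  also have "4 / real (card (box x (rad k))) \<le> 4 / (c * vol_scale k)"
    using good[OF assms(1)] c vol_scale_pos by (intro frac_le) auto
  also have "10 * real (rad k) / real (2 ^ (k - 2)) \<le> 40 * sqrt (2 ^ k / real k) / 2 ^ k"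
    using rad_bounds(2)[OF large] unfolding k4 by (simp add: field_simps)
  also have "sqrt (2 ^ k / real k) = 2 ^ k / vol_scale k"
    using k_ge_8 by (simp add: vol_scale_def real_sqrt_divide real_sqrt_mult field_simps)
  finally show ?thesis
    using c by (simp add: heat_const_def add_divide_distrib)
qed

lemma psi_le_high:
  assumes "v \<in> CV"
  shows "psi (2 * 2 ^ (k - 2)) v \<le> 15 / sqrt (2 ^ k)"
proof -
  define i where "i = (k - 2) div 2"
  have "2 * i \<le> k - 2" "k \<le> 2 * i + 3" using k_ge_8 by (auto simp: i_def)
  then have a: "(2::real) ^ (2 * i) \<le> 2 ^ (k - 2)" "(2::real) ^ k \<le> 2 ^ (2 * i + 3)"
    by (intro power_increasing; simp)+
  have "psi (2 * 2 ^ (k - 2)) v \<le> 4 / real (2 ^ i) + real (2 ^ i) / real (2 ^ (k - 2))"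
    using assms by (intro psi_le_any) auto
  also have "real (2 ^ i) / real (2 ^ (k - 2)) \<le> 1 / 2 ^ i"
    using a(1) by (simp add: divide_simps power_mult power2_eq_square power_even_eq flip: power_mult_distrib)
  also have "4 / real (2 ^ i) + 1 / 2 ^ i = 5 / 2 ^ i" by simp
  also have "\<dots> \<le> 15 / sqrt (2 ^ k)"
  proof -
    have "sqrt (2 ^ k) \<le> 3 * 2 ^ i"
      using a(2) by (intro real_le_lsqrt)
        (auto simp: power_mult_distrib power_add power_even_eq intro: order_trans)
    then show ?thesis by (simp add: field_simps)
  qed
  finally show ?thesis by simp
qed

lemma p_le_aux:
  assumes "2 ^ k \<le> n" "v \<in> CV" "psi (2 * 2 ^ (k - 2)) v \<le> b"
  shows "p n orig v \<le> 3 * sqrt (K / vol_scale k * b)"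
proof (rule p_le_psi[OF orig_in_CV assms(2) _ _ assms(3)])
  have "2 * (2 * 2 ^ (k - 2)) = (2::nat) ^ k"
    using two_power_quarter[of k, where 'a = nat] k_ge_8 by simp
  then show "2 * 2 ^ (k - 2) \<le> n div 2" using assms(1) by linarith
  show "psi (2 * 2 ^ (k - 2)) orig \<le> K / vol_scale k"
    using H_nonneg by (intro psi_le_low) auto
qed

lemma supp_coordinate:
  assumes "v \<in> supp n orig" "n \<le> 4 * 2 ^ k"
  shows "\<bar>fst v\<bar> \<le> 4 * 2 ^ k" "v \<in> CV"
proof -
  have "\<bar>fst v\<bar> \<le> int n" using supp_spine_coordinate[OF orig_in_CV assms(1)] by simp
  also have "\<dots> \<le> int (4 * 2 ^ k)" using assms(2) by (simp only: of_nat_le_iff)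
  finally show "\<bar>fst v\<bar> \<le> 4 * 2 ^ k" by simp
  show "v \<in> CV" using supp_subset[OF orig_in_CV] assms(1) by blast
qed

lemma p_le_low:
  assumes "2 ^ k \<le> n" "n \<le> 4 * 2 ^ k" "v \<in> supp n orig" "snd v \<le> rad k"
  shows "p n orig v \<le> 3 * K / vol_scale k"
proof -
  obtain x l where v: "v = (x, l)" by force
  have "psi (2 * 2 ^ (k - 2)) v \<le> K / vol_scale k"
    unfolding v using supp_coordinate[OF assms(3,2)] assms(4) v by (intro psi_le_low) auto
  then have "p n orig v \<le> 3 * sqrt (K / vol_scale k * (K / vol_scale k))"
    using assms supp_coordinate by (intro p_le_aux) auto
  then show ?thesis using K_pos vol_scale_pos by (simp add: real_sqrt_mult_self flip: power2_eq_square times_divide_times_eq)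
qed

text \<open>Geometric mean of the box bound at the origin and the universal bound at
  \<open>v\<close>. It has order 2^(-k/2) k^(-1/4), a factor k^(1/4) worse than
  \<open>p_le_low\<close>.\<close>

lemma p_le_high:
  assumes "2 ^ k \<le> n" "n \<le> 4 * 2 ^ k" "v \<in> supp n orig"
  shows "p n orig v \<le> 3 * sqrt (K / vol_scale k * (15 / sqrt (2 ^ k)))"
  using assms supp_coordinate by (intro p_le_aux psi_le_high) auto

text \<open>Vertices beyond \<open>wid k\<close> are handled by the second moment of the spine
  coordinate and \<open>wid_ge\<close>. The others are counted, each with weight at most the bound
  of \<open>p_le_low\<close>.\<close>

lemma sum_p_shallow:
  assumes "2 ^ k \<le> n" "n \<le> 2 * 2 ^ k"
  defines "S \<equiv> {(x, l). l < 2 ^ lvl k} \<inter> supp n orig"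
  shows "(\<Sum>v\<in>S. p n orig v) \<le> 2 / (real (lvl k))\<^sup>2 + real (card (low_verts k)) * (3 * K / vol_scale k)"
proof -
  let ?far = "{v. int (wid k) < \<bar>fst v\<bar>}"
  have fin: "finite (supp n orig)" by (rule finite_supp[OF orig_in_CV])
  have lvl: "0 < lvl k" using lvl_pos k_ge_8 by simp
  then have wid: "0 < wid k" by (simp add: wid_def)
  have "(\<Sum>v\<in>supp n orig \<inter> ?far. p n orig v) \<le> ((real_of_int (fst orig))\<^sup>2 + real n * 1) / (real (wid k))\<^sup>2"
  proof (rule tail_drift[OF drift_spine_coordinate orig_in_CV])
    show "(real (wid k))\<^sup>2 \<le> (real_of_int (fst v))\<^sup>2" if "v \<in> ?far" for v
      using that by (simp add: abs_le_square_iff[symmetric])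
  qed (use wid in auto)
  also have "\<dots> \<le> 2 * 2 ^ k / (2 ^ k * (real (lvl k))\<^sup>2)"
  proof (rule frac_le)
    have "real n \<le> real (2 * 2 ^ k)" using assms(2) by (simp only: of_nat_le_iff)
    then show "(real_of_int (fst orig))\<^sup>2 + real n * 1 \<le> 2 * 2 ^ k" by simp
  qed (use wid_ge lvl in auto)
  also have "\<dots> = 2 / (real (lvl k))\<^sup>2" by simp
  finally have far: "(\<Sum>v\<in>S \<inter> ?far. p n orig v) \<le> 2 / (real (lvl k))\<^sup>2"
    using fin by (elim order_trans[rotated]) (intro sum_mono2, auto simp: S_def)
  have lr: "2 ^ lvl k \<le> rad k" by (rule two_power_lvl_le[OF large])
  have "(\<Sum>v\<in>S - ?far. p n orig v) \<le> (\<Sum>v\<in>S - ?far. 3 * K / vol_scale k)"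
    using assms(1,2) lr by (intro sum_mono p_le_low) (auto simp: S_def)
  also have "\<dots> = real (card (S - ?far)) * (3 * K / vol_scale k)" by simp
  also have "\<dots> \<le> real (card (low_verts k)) * (3 * K / vol_scale k)"
  proof (rule mult_right_mono)
    have "S - ?far \<subseteq> low_verts k"
      using supp_subset[OF orig_in_CV, of n] by (auto simp: S_def low_verts_def simp flip: in_CV)
    then show "real (card (S - ?far)) \<le> real (card (low_verts k))"
      using card_mono[OF finite_low_verts] by simp
  qed (use K_pos vol_scale_pos in auto)
  finally have "(\<Sum>v\<in>S - ?far. p n orig v) \<le> real (card (low_verts k)) * (3 * K / vol_scale k)" .
  moreover have "(\<Sum>v\<in>S. p n orig v) = (\<Sum>v\<in>S \<inter> ?far. p n orig v) + (\<Sum>v\<in>S - ?far. p n orig v)"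
    using fin by (intro sum.Int_Diff) (auto simp: S_def)
  ultimately show ?thesis using far by simp
qed

text \<open>Block length times the squared supremum: what is left of the sum of cubes when one
  factor is summed to 1. The order 1/k is the borderline first moment.\<close>

lemma alpha_square: "2 ^ k * (3 * K / vol_scale k)\<^sup>2 = 9 * K\<^sup>2 / real k"
  using k_ge_8 by (simp add: vol_scale_def power_divide power_mult_distrib field_simps)

lemma beta_square: "2 ^ k * (3 * sqrt (K / vol_scale k * (15 / sqrt (2 ^ k))))\<^sup>2 = 135 * K / sqrt (real k)"
proof -
  have "(sqrt (K / vol_scale k * (15 / sqrt (2 ^ k))))\<^sup>2 = K / vol_scale k * (15 / sqrt (2 ^ k))"
    using K_pos vol_scale_pos by (intro real_sqrt_pow2) auto
  also have "\<dots> = 15 * K / (2 ^ k * sqrt (real k))"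
    by (simp add: vol_scale_def real_sqrt_mult field_simps)
  finally show ?thesis by (simp add: power_mult_distrib)
qed

text \<open>No clustering is used here; the gain over 1/k is the small mass of the shallow
  vertices.\<close>

lemma prob_shallow:
  "measure (srw3 CE orig) (collisions (2 ^ k) (2 ^ k - 1) {(x, l). l < 2 ^ lvl k}) \<le>
     9 * K\<^sup>2 / real k * (2 / (real (lvl k))\<^sup>2 + real (card (low_verts k)) * (3 * K / vol_scale k))"
proof -
  let ?D = "{(x, l). l < 2 ^ lvl k} :: (int \<times> nat) set"
  let ?\<alpha> = "3 * K / vol_scale k"
  let ?T = "2 / (real (lvl k))\<^sup>2 + real (card (low_verts k)) * (3 * K / vol_scale k)"
  have "1 * measure (srw3 CE orig) (collisions (2 ^ k) (2 ^ k - 1) ?D) \<le>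
      (\<Sum>i\<le>(2 ^ k - 1) + 0. \<Sum>v\<in>?D \<inter> supp (2 ^ k + i) orig. p (2 ^ k + i) orig v ^ 3)"
    unfolding collisions_def
  proof (rule triple_collision_prob_le[OF orig_in_CV])
    fix v assume "v \<in> CV \<inter> ?D"
    then show "\<exists>A. (\<forall>i. finite (A i) \<and> A i \<subseteq> ?D) \<and> 1 \<le> (\<Sum>i\<le>0. \<Sum>w\<in>A i. p i v w ^ 3)"
      by (intro exI[of _ "\<lambda>_. {v}"]) (auto simp: p_0)
  qed simp
  also have "\<dots> \<le> (\<Sum>i\<le>(2 ^ k - 1) + (0::nat). ?\<alpha>\<^sup>2 * ?T)"
  proof (rule sum_mono)
    fix i assume "i \<in> {..2 ^ k - 1 + (0::nat)}"
    then have i: "2 ^ k + i \<le> 2 * 2 ^ k" by simp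
    have lr: "2 ^ lvl k \<le> rad k" by (rule two_power_lvl_le[OF large])
    have "(\<Sum>v\<in>?D \<inter> supp (2 ^ k + i) orig. p (2 ^ k + i) orig v ^ 3) \<le>
        ?\<alpha>\<^sup>2 * (\<Sum>v\<in>?D \<inter> supp (2 ^ k + i) orig. p (2 ^ k + i) orig v)"
      using i lr K_pos vol_scale_pos finite_supp[OF orig_in_CV]
      by (intro sum_cubes_le p_le_low) (auto simp del: chain.simps)
    also have "\<dots> \<le> ?\<alpha>\<^sup>2 * ?T"
      using i by (intro mult_left_mono sum_p_shallow) auto
    finally show "(\<Sum>v\<in>?D \<inter> supp (2 ^ k + i) orig. p (2 ^ k + i) orig v ^ 3) \<le> ?\<alpha>\<^sup>2 * ?T" .
  qed
  also have "\<dots> = (2 ^ k * ?\<alpha>\<^sup>2) * ?T" by (simp add: of_nat_diff)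
  finally show ?thesis unfolding alpha_square by simp
qed

text \<open>\<open>B\<close> is where the cluster collisions are counted: same tooth, up to twice
  the height. 120 = 60 * 2, where 60 is the constant of \<open>cluster_size\<close> and 2 accounts
  for the time window lengthened by one cluster.\<close>

lemma prob_clusters:
  fixes D B :: "(int \<times> nat) set"
  assumes s: "0 < s" "s \<le> k div 4" and \<alpha>: "0 \<le> \<alpha>"
    and D: "\<And>x l. (x, l) \<in> D \<Longrightarrow> 2 ^ s \<le> l"
    and B: "\<And>x l j. (x, l) \<in> D \<Longrightarrow> j < 2 * l \<Longrightarrow> (x, j) \<in> B"
    and p: "\<And>n v. 2 ^ k \<le> n \<Longrightarrow> n \<le> 4 * 2 ^ k \<Longrightarrow> v \<in> supp n orig \<Longrightarrow> v \<in> B \<Longrightarrow> p n orig v \<le> \<alpha>"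
  shows "measure (srw3 CE orig) (collisions (2 ^ k) (2 ^ k - 1) D) \<le> 120 * (2 ^ k * \<alpha>\<^sup>2) / real s"
proof -
  let ?M = "4 ^ (s - 1) :: nat"
  have M: "?M \<le> 2 ^ k" by (rule four_power_le[OF s(2)])
  have "real s / 60 * measure (srw3 CE orig) (collisions (2 ^ k) (2 ^ k - 1) D) \<le>
      (\<Sum>i\<le>(2 ^ k - 1) + ?M. \<Sum>v\<in>B \<inter> supp (2 ^ k + i) orig. p (2 ^ k + i) orig v ^ 3)"
    unfolding collisions_def
  proof (rule triple_collision_prob_le[OF orig_in_CV])
    fix v assume v: "v \<in> CV \<inter> D"
    obtain x l where xl: "v = (x, l)" by force
    show "\<exists>A. (\<forall>i. finite (A i) \<and> A i \<subseteq> B) \<and> real s / 60 \<le> (\<Sum>i\<le>?M. \<Sum>w\<in>A i. p i v w ^ 3)"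
    proof (intro exI conjI allI)
      show "real s / 60 \<le> (\<Sum>i\<le>?M. \<Sum>w\<in>supp i v \<inter> {(y, j). y = x \<and> j < 2 * l}. p i v w ^ 3)"
        unfolding xl using v xl D s(1) by (intro cluster_size) auto
      show "supp i v \<inter> {(y, j). y = x \<and> j < 2 * l} \<subseteq> B" for i using B v xl by auto
      show "finite (supp i v \<inter> {(y, j). y = x \<and> j < 2 * l})" for i using finite_supp v by auto
    qed
  qed simp
  also have "\<dots> \<le> (\<Sum>i\<le>(2 ^ k - 1) + ?M. \<alpha>\<^sup>2 * 1)"
  proof (rule sum_mono)
    fix i assume "i \<in> {..2 ^ k - 1 + ?M}"
    then have i: "2 ^ k + i \<le> 4 * 2 ^ k" using M by simp
    have "(\<Sum>v\<in>B \<inter> supp (2 ^ k + i) orig. p (2 ^ k + i) orig v ^ 3) \<le>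
        \<alpha>\<^sup>2 * (\<Sum>v\<in>B \<inter> supp (2 ^ k + i) orig. p (2 ^ k + i) orig v)"
      using i \<alpha> finite_supp[OF orig_in_CV] by (intro sum_cubes_le p) auto
    also have "\<dots> \<le> \<alpha>\<^sup>2 * 1"
      using finite_supp[OF orig_in_CV] by (intro mult_left_mono sum_p_le_1) auto
    finally show "(\<Sum>v\<in>B \<inter> supp (2 ^ k + i) orig. p (2 ^ k + i) orig v ^ 3) \<le> \<alpha>\<^sup>2 * 1" .
  qed
  also have "\<dots> = real (2 ^ k + ?M) * \<alpha>\<^sup>2" by (simp add: of_nat_diff)
  also have "\<dots> \<le> real (2 ^ k + 2 ^ k) * \<alpha>\<^sup>2"
    using M by (intro mult_right_mono) (simp_all only: of_nat_le_iff add_left_mono zero_le_power2)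
  finally show ?thesis using s(1) by (simp add: field_simps)
qed

text \<open>Heights are cut at 2^(lvl k) and 2^(k div 4). Constants: 18 = 9 * 2 for shallow vertices
  far out and 27 = 9 * 3 for the counted ones, 1080 = 120 * 9 for the middle range, 129600 = 120 *
  135 * 8 for the top, with 8 from k div 4 >= k / 8.\<close>

lemma prob_collision_le:
  "measure (srw3 CE orig) (collisions (2 ^ k) (2 ^ k - 1) UNIV) \<le>
     (18 * K\<^sup>2 + 1080 * K\<^sup>2 + 129600 * K) * real k powr (- 9 / 8) +
     27 * K ^ 3 * (real (card (low_verts k)) / (real k * vol_scale k))"
proof -
  interpret srw3: prob_space "srw3 CE orig" by (rule prob_space_srw3)
  let ?C = "collisions (2 ^ k) (2 ^ k - 1) :: (int \<times> nat) set \<Rightarrow> _"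
  let ?D0 = "{(x, l). l < 2 ^ lvl k} :: (int \<times> nat) set"
  let ?D1 = "{(x, l). 2 ^ lvl k \<le> l \<and> l < 2 ^ (k div 4)} :: (int \<times> nat) set"
  let ?D2 = "{(x, l). 2 ^ (k div 4) \<le> l} :: (int \<times> nat) set"
  have L: "0 < lvl k" "lvl k \<le> k div 4" "2 * 2 ^ (k div 4) \<le> rad k"
    using lvl_pos k_ge_8 large by (auto simp: large_index_def)
  have sets: "?C D \<in> sets (srw3 CE orig)" for D
    unfolding collisions_def by (rule triple_collision_event_sets(1))
  have "measure (srw3 CE orig) (?C UNIV) \<le> measure (srw3 CE orig) (?C ?D0 \<union> ?C ?D1 \<union> ?C ?D2)"
    using sets by (intro srw3.finite_measure_mono) (fastforce simp: collisions_def)+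
  also have "\<dots> \<le> measure (srw3 CE orig) (?C ?D0) + measure (srw3 CE orig) (?C ?D1) + measure (srw3 CE orig) (?C ?D2)"
    using sets by (intro order_trans[OF measure_Un_le] add_mono order_refl) auto
  finally have sum: "measure (srw3 CE orig) (?C UNIV) \<le>
    measure (srw3 CE orig) (?C ?D0) + measure (srw3 CE orig) (?C ?D1) + measure (srw3 CE orig) (?C ?D2)" .
  have k0: "0 < real k" using k_ge_8 by simp
  define e where "e = real k powr (1 / 8)"
  have e: "0 < e" "e \<le> real (lvl k)" "1 \<le> real (lvl k)" using k0 lvl_ge L(1) by (auto simp: e_def)
  have ke: "1 / (real k * e) = real k powr (- 9 / 8)"
    using powr_mult_base[of "real k" "1 / 8"] by (simp add: e_def powr_minus_divide)
  \<comment> \<open>Doubled heights from this range stay at most \<open>rad k\<close>, so the box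
    bound covers whole clusters.\<close>
  have "measure (srw3 CE orig) (?C ?D1) \<le> 120 * (2 ^ k * (3 * K / vol_scale k)\<^sup>2) / real (lvl k)"
    by (rule prob_clusters[where B = "{(x, l). l \<le> rad k}"])
      (use L p_le_low K_pos vol_scale_pos in \<open>auto simp del: chain.simps\<close>)
  also have "\<dots> = 1080 * K\<^sup>2 / (real k * real (lvl k))"
    unfolding alpha_square by simp
  also have "\<dots> \<le> 1080 * K\<^sup>2 / (real k * e)"
    using e k0 by (intro divide_left_mono) auto
  also have "\<dots> = 1080 * K\<^sup>2 * real k powr (- 9 / 8)"
    unfolding ke[symmetric] by simp
  finally have D1: "measure (srw3 CE orig) (?C ?D1) \<le> 1080 * K\<^sup>2 * real k powr (- 9 / 8)" .
  have k8: "real k / 8 \<le> real (k div 4)" using k_ge_8 by linarith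
  have "measure (srw3 CE orig) (?C ?D2) \<le>
      120 * (2 ^ k * (3 * sqrt (K / vol_scale k * (15 / sqrt (2 ^ k))))\<^sup>2) / real (k div 4)"
    by (rule prob_clusters[where B = UNIV])
      (use L p_le_high K_pos vol_scale_pos in \<open>auto simp del: chain.simps\<close>)
  also have "\<dots> = 16200 * K / (sqrt (real k) * real (k div 4))"
    unfolding beta_square by simp
  also have "\<dots> \<le> 16200 * K / (sqrt (real k) * (real k / 8))"
    using k8 k0 K_pos L by (intro divide_left_mono mult_left_mono mult_pos_pos) auto
  also have "\<dots> = 129600 * K * (1 / (real k * sqrt (real k)))" by simp
  also have "\<dots> \<le> 129600 * K * (1 / (real k * e))"
  proof -
    have "e \<le> real k powr (1 / 2)" unfolding e_def using k_ge_8 by (intro powr_mono) auto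
    then have "e \<le> sqrt (real k)" by (simp add: powr_half_sqrt)
    then show ?thesis using K_pos k0 e by (intro mult_left_mono divide_left_mono mult_pos_pos) auto
  qed
  finally have D2: "measure (srw3 CE orig) (?C ?D2) \<le> 129600 * K * real k powr (- 9 / 8)"
    unfolding ke .
  have "measure (srw3 CE orig) (?C ?D0) \<le>
      9 * K\<^sup>2 / real k * (2 / (real (lvl k))\<^sup>2 + real (card (low_verts k)) * (3 * K / vol_scale k))"
    by (rule prob_shallow)
  also have "\<dots> \<le> 9 * K\<^sup>2 / real k * (2 / e + real (card (low_verts k)) * (3 * K / vol_scale k))"
  proof (intro mult_left_mono add_right_mono divide_left_mono)
    show "e \<le> (real (lvl k))\<^sup>2"
      using e mult_mono[of e "real (lvl k)" 1 "real (lvl k)"] by (simp add: power2_eq_square)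
  qed (use e k0 in auto)
  also have "\<dots> = 18 * K\<^sup>2 * (1 / (real k * e)) + 27 * K ^ 3 * (real (card (low_verts k)) / (real k * vol_scale k))"
    using e k0 vol_scale_pos by (simp add: field_simps power2_eq_square power3_eq_cube)
  finally have D0: "measure (srw3 CE orig) (?C ?D0) \<le>
      18 * K\<^sup>2 * real k powr (- 9 / 8) + 27 * K ^ 3 * (real (card (low_verts k)) / (real k * vol_scale k))"
    unfolding ke .
  show ?thesis
    using sum D0 D1 D2 by (simp add: algebra_simps)
qed

end

text \<open>Everything random about the comb is isolated in two deterministic hypotheses. For low
  vertices only summability is asked, since that follows from expectations alone.\<close>

theorem finite_triple_collisions:
  assumes c: "0 < c"
    and good: "\<forall>\<^sub>F k in sequentially. \<forall>x. \<bar>x\<bar> \<le> 4 * 2 ^ k \<longrightarrow> c * vol_scale k \<le> real (card (box x (rad k)))"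
    and low: "summable (\<lambda>k. real (card (low_verts k)) / (real k * vol_scale k))"
  shows "finite_triple_collision_property CV CE"
  unfolding finite_triple_collision_property_def
proof (rule bexI[OF _ orig_in_CV])
  interpret srw3: prob_space "srw3 CE orig" by (rule prob_space_srw3)
  let ?A = "\<lambda>k. collisions (2 ^ k) (2 ^ k - 1) (UNIV :: (int \<times> nat) set)"
  let ?K = "heat_const c"
  have prob: "\<forall>\<^sub>F k in sequentially. measure (srw3 CE orig) (?A k) \<le>
      (18 * ?K\<^sup>2 + 1080 * ?K\<^sup>2 + 129600 * ?K) * real k powr (- 9 / 8) +
      27 * ?K ^ 3 * (real (card (low_verts k)) / (real k * vol_scale k))"
    using good eventually_large_index
  proof eventually_elim
    case (elim k)
    show ?case
      by (rule prob_collision_le[OF elim(2) c]) (use elim(1) in blast)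
  qed
  have "summable (\<lambda>k. (18 * ?K\<^sup>2 + 1080 * ?K\<^sup>2 + 129600 * ?K) * real k powr (- 9 / 8) +
      27 * ?K ^ 3 * (real (card (low_verts k)) / (real k * vol_scale k)))"
    using low by (intro summable_add summable_mult) (auto simp: summable_real_powr_iff)
  then have "summable (\<lambda>k. measure (srw3 CE orig) (?A k))"
    by (rule summable_comparison_test_ev[rotated]) (use prob in simp)
  moreover have "?A k \<in> sets (srw3 CE orig)" for k
    unfolding collisions_def by (rule triple_collision_event_sets(1))
  ultimately have "AE X in srw3 CE orig. \<forall>\<^sub>F k in sequentially. X \<in> space (srw3 CE orig) - ?A k"
    by (intro borel_cantelli_AE1) (auto simp: srw3.emeasure_eq_measure)
  then have "AE X in srw3 CE orig. case X of (X1, X2, X3) \<Rightarrow> finite {n. X1 n = X2 n \<and> X2 n = X3 n}"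
  proof eventually_elim
    case (elim X)
    obtain X1 X2 X3 where X: "X = (X1, X2, X3)" by (cases X) auto
    obtain k\<^sub>0 where k\<^sub>0: "\<And>k. k\<^sub>0 \<le> k \<Longrightarrow> X \<notin> ?A k"
      using elim by (auto simp: eventually_sequentially)
    have "{n. X1 n = X2 n \<and> X2 n = X3 n} \<subseteq> {..<2 ^ k\<^sub>0}"
    proof
      fix n assume n: "n \<in> {n. X1 n = X2 n \<and> X2 n = X3 n}"
      show "n \<in> {..<2 ^ k\<^sub>0}"
      proof (rule ccontr)
        assume "n \<notin> {..<2 ^ k\<^sub>0}"
        then have ge: "2 ^ k\<^sub>0 \<le> n" by simp
        then have "0 < n" by (metis gr0I not_le zero_less_numeral zero_less_power)
        then obtain k where k: "2 ^ k \<le> n" "n < 2 ^ (k + 1)"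
          using ex_power_ivl1[of 2 n] by auto
        have "k\<^sub>0 \<le> k"
          using ge k(2) power_less_imp_less_exp[of "2::nat" k\<^sub>0 "k + 1"] by simp
        then have "X \<notin> ?A k" by (rule k\<^sub>0)
        moreover have "n \<in> {2 ^ k..2 ^ k + (2 ^ k - 1)}" using k by simp
        ultimately show False using n unfolding X collisions_def by blast
      qed
    qed
    then show ?case unfolding X by (auto intro: finite_subset)
  qed
  then show "AE (X1, X2, X3) in srw_law CE orig \<Otimes>\<^sub>M srw_law CE orig \<Otimes>\<^sub>M srw_law CE orig.
      finite {n. X1 n = X2 n \<and> X2 n = X3 n}"
    unfolding srw3_def .
qed

end

section \<open>The random environment\<close>

lemma AE_summable_of_summable_integrals:
  fixes f :: "nat \<Rightarrow> 'w \<Rightarrow> real"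
  assumes int: "\<And>k. integrable M (f k)" and nn: "\<And>k \<omega>. 0 \<le> f k \<omega>"
    and sum: "summable (\<lambda>k. integral\<^sup>L M (f k))"
  shows "AE \<omega> in M. summable (\<lambda>k. f k \<omega>)"
proof -
  have "(\<integral>\<^sup>+\<omega>. (\<Sum>k. ennreal (f k \<omega>)) \<partial>M) = (\<Sum>k. \<integral>\<^sup>+\<omega>. ennreal (f k \<omega>) \<partial>M)"
    using int by (intro nn_integral_suminf) auto
  also have "\<dots> = (\<Sum>k. ennreal (integral\<^sup>L M (f k)))"
    using nn by (intro suminf_cong nn_integral_eq_integral int) auto
  also have "\<dots> = ennreal (\<Sum>k. integral\<^sup>L M (f k))"
    using nn by (intro suminf_ennreal2 sum integral_nonneg) auto
  finally have "(\<integral>\<^sup>+\<omega>. (\<Sum>k. ennreal (f k \<omega>)) \<partial>M) \<noteq> \<infinity>" by simp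
  then have "AE \<omega> in M. (\<Sum>k. ennreal (f k \<omega>)) \<noteq> \<infinity>"
    using int by (intro nn_integral_noteq_infinite) auto
  then show ?thesis
    by eventually_elim (use nn in \<open>auto intro: summable_suminf_not_top\<close>)
qed

lemma harm_le_ln: "0 < n \<Longrightarrow> harm n \<le> 1 + ln (real n)"
  using decseqD[OF decseq_harm_diff_ln, of 0 "n - 1"] by (simp add: harm_expand)

lemma real_card_filter: "finite A \<Longrightarrow> real (card {l \<in> A. P l}) = (\<Sum>l\<in>A. if P l then 1 else 0)"
  by (simp add: sum.If_cases Int_def)

locale iid_tail_one = prob_space M for M :: "'w measure" +
  fixes H :: "int \<Rightarrow> 'w \<Rightarrow> real" and C :: real
  assumes C_pos: "0 < C"
    and indep: "indep_vars (\<lambda>_. borel) H UNIV"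
    and identically_distributed: "\<And>x. distr M borel (H x) = distr M borel (H 0)"
    and nonneg: "\<And>x \<omega>. \<omega> \<in> space M \<Longrightarrow> 0 \<le> H x \<omega>"
    and tail: "((\<lambda>z. z * prob {\<omega> \<in> space M. H 0 \<omega> > z}) \<longlongrightarrow> C) at_top"
begin

lemma H_measurable [measurable]: "H x \<in> borel_measurable M"
  using indep by (auto simp: indep_vars_def)

text \<open>The weak inequality is the condition for the vertex at height \<open>l\<close> to exist;
  the tail hypothesis uses the strict one.\<close>

definition G :: "nat \<Rightarrow> real" where "G l = prob {\<omega> \<in> space M. real l \<le> H 0 \<omega>}"

lemma prob_tooth_ge: "prob {\<omega> \<in> space M. real l \<le> H x \<omega>} = G l"
proof -
  have "prob {\<omega> \<in> space M. real l \<le> H x \<omega>} = measure (distr M borel (H x)) {real l..}" for x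
    by (subst measure_distr) (auto intro!: arg_cong[where f = prob])
  then show ?thesis unfolding G_def by (simp add: identically_distributed[of x])
qed

lemma G_nonneg: "0 \<le> G l" and G_le_1: "G l \<le> 1"
  by (simp_all add: G_def)

text \<open>Passing from the weak to the strict inequality at half the height costs a factor 2; for
  small \<open>l\<close> the constant is enlarged until the bound exceeds 1.\<close>

lemma G_upper: "\<exists>K>0. \<forall>l>0. G l \<le> K / real l"
proof -
  have "\<forall>\<^sub>F z in at_top. z * prob {\<omega> \<in> space M. H 0 \<omega> > z} < C + 1"
    by (rule order_tendstoD[OF tail]) simp
  then obtain z\<^sub>0 where z\<^sub>0: "\<And>z. z\<^sub>0 \<le> z \<Longrightarrow> z * prob {\<omega> \<in> space M. H 0 \<omega> > z} < C + 1"
    unfolding eventually_at_top_linorder by blast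
  define K where "K = max (2 * (C + 1)) (2 * z\<^sub>0)"
  have "G l \<le> K / real l" if l: "0 < l" for l
  proof (cases "z\<^sub>0 \<le> real l / 2")
    case True
    have "G l \<le> prob {\<omega> \<in> space M. H 0 \<omega> > real l / 2}"
      unfolding G_def using l by (intro finite_measure_mono) auto
    moreover have "real l / 2 * prob {\<omega> \<in> space M. H 0 \<omega> > real l / 2} \<le> C + 1"
      using z\<^sub>0[OF True] by simp
    ultimately have "real l / 2 * G l \<le> C + 1"
      using mult_left_mono[of "G l" "prob {\<omega> \<in> space M. H 0 \<omega> > real l / 2}" "real l / 2"] by simp
    then have "real l * G l \<le> K" unfolding K_def by simp
    then show ?thesis using l by (simp add: field_simps)
  next
    case False
    then have "real l \<le> K" unfolding K_def by simp
    then have "1 \<le> K / real l" using l by simp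
    then show ?thesis using G_le_1[of l] by simp
  qed
  moreover have "K > 0" using C_pos by (simp add: K_def less_max_iff_disj)
  ultimately show ?thesis by blast
qed

lemma G_lower: "\<exists>l\<^sub>0>0. \<forall>l\<ge>l\<^sub>0. C / 2 / real l \<le> G l"
proof -
  have "\<forall>\<^sub>F z in at_top. C / 2 < z * prob {\<omega> \<in> space M. H 0 \<omega> > z}"
    by (rule order_tendstoD[OF tail]) (use C_pos in simp)
  then obtain z\<^sub>0 where z\<^sub>0: "\<And>z. z\<^sub>0 \<le> z \<Longrightarrow> C / 2 < z * prob {\<omega> \<in> space M. H 0 \<omega> > z}"
    unfolding eventually_at_top_linorder by blast
  have "C / 2 / real l \<le> G l" if l: "Suc (nat \<lceil>z\<^sub>0\<rceil>) \<le> l" for l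
  proof -
    have l0: "0 < real l" "z\<^sub>0 \<le> real l" using l by linarith+
    have "C / 2 < real l * prob {\<omega> \<in> space M. H 0 \<omega> > real l}" by (rule z\<^sub>0[OF l0(2)])
    also have "\<dots> \<le> real l * G l"
      unfolding G_def by (intro mult_left_mono finite_measure_mono) auto
    finally show ?thesis using l0 by (simp add: field_simps)
  qed
  then show ?thesis by blast
qed

lemma comb_sample: "\<omega> \<in> space M \<Longrightarrow> comb (\<lambda>x. H x \<omega>)"
  by unfold_locales (rule nonneg)


subsection \<open>There are few low vertices\<close>

definition low_count :: "nat \<Rightarrow> 'w \<Rightarrow> real" where
  "low_count k \<omega> = (\<Sum>y\<in>{- int (wid k)..int (wid k)}. \<Sum>l<2 ^ lvl k. indicator {\<omega> \<in> space M. real l \<le> H y \<omega>} \<omega>)"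

lemma card_low_verts:
  assumes \<omega>: "\<omega> \<in> space M"
  shows "real (card (comb.low_verts (\<lambda>x. H x \<omega>) k)) = low_count k \<omega>"
proof -
  interpret comb "\<lambda>x. H x \<omega>" by (rule comb_sample[OF \<omega>])
  have "low_verts k = (SIGMA y:{- int (wid k)..int (wid k)}. {l \<in> {..<2 ^ lvl k}. real l \<le> H y \<omega>})"
    by (auto simp: low_verts_def)
  then have "real (card (low_verts k)) =
      (\<Sum>y\<in>{- int (wid k)..int (wid k)}. real (card {l \<in> {..<2 ^ lvl k}. real l \<le> H y \<omega>}))"
    by simp
  also have "\<dots> = low_count k \<omega>"
    unfolding low_count_def
  proof (rule sum.cong[OF refl])
    fix y
    show "real (card {l \<in> {..<2 ^ lvl k}. real l \<le> H y \<omega>}) =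
        (\<Sum>l<2 ^ lvl k. indicator {\<omega> \<in> space M. real l \<le> H y \<omega>} \<omega>)"
      unfolding real_card_filter[OF finite_lessThan]
      by (rule sum.cong[OF refl]) (simp add: indicator_def \<omega>)
  qed
  finally show ?thesis .
qed

lemma integrable_low_count: "integrable M (low_count k)"
  unfolding low_count_def[abs_def]
  by (intro Bochner_Integration.integrable_sum integrable_real_indicator) (auto simp: emeasure_eq_measure)

lemma expectation_low_count:
  "expectation (low_count k) = (2 * real (wid k) + 1) * (\<Sum>l<2 ^ lvl k. G l)"
proof -
  have "expectation (low_count k) = (\<Sum>y\<in>{- int (wid k)..int (wid k)}. \<Sum>l<2 ^ lvl k. G l)"
    unfolding low_count_def
    by (simp add: Bochner_Integration.integral_sum Bochner_Integration.integrable_sum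
        integrable_real_indicator emeasure_eq_measure prob_tooth_ge)
  then show ?thesis by (simp add: algebra_simps)
qed

text \<open>By \<open>G_upper\<close> a tooth has of order \<open>lvl k\<close> vertices below
  2^(lvl k), so the mean count is of order 2^(k/2) (lvl k)^2, and the quotient is of order k^(-5/4).
  Summable expectations give almost sure summability, so no concentration is required.\<close>

lemma AE_summable_low_verts:
  "AE \<omega> in M. summable (\<lambda>k. real (card (comb.low_verts (\<lambda>x. H x \<omega>) k)) / (real k * vol_scale k))"
proof -
  obtain K where K: "0 < K" "\<And>l. 0 < l \<Longrightarrow> G l \<le> K / real l" using G_upper by blast
  have sumG: "(\<Sum>l<2 ^ s. G l) \<le> 1 + K + K * real s" for s
  proof -
    have "(\<Sum>l<2 ^ s. G l) \<le> (\<Sum>l\<in>insert 0 {1..2 ^ s}. G l)"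
      by (intro sum_mono2) (auto simp: G_nonneg)
    also have "\<dots> = G 0 + (\<Sum>l\<in>{1..2 ^ s}. G l)" by (rule sum.insert) auto
    also have "\<dots> \<le> 1 + (\<Sum>l\<in>{1..2 ^ s}. K / real l)"
      by (intro add_mono G_le_1 sum_mono K) auto
    also have "\<dots> = 1 + K * harm (2 ^ s)"
      unfolding harm_def sum_distrib_left divide_inverse by (rule refl)
    also have "\<dots> \<le> 1 + K * (1 + ln (real (2 ^ s)))"
      using K(1) by (intro add_left_mono mult_left_mono harm_le_ln) auto
    also have "ln (real (2 ^ s)) = real s * ln 2" by (simp add: ln_realpow)
    also have "\<dots> \<le> real s * 1" using ln_le_minus_one[of 2] by (intro mult_left_mono) auto
    finally show ?thesis using K(1) by (simp add: algebra_simps)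
  qed
  have bound: "expectation (low_count k) / (real k * vol_scale k) \<le>
      24 * (1 + 2 * K) * real k powr (- 5 / 4)" if k: "1 \<le> k" for k
  proof -
    have L: "1 \<le> real (lvl k)" using lvl_pos[of k] k by simp
    have "0 < wid k" using lvl_pos[of k] k by (simp add: wid_def)
    then have wL: "1 \<le> real (wid k)" by simp
    have "real (wid k) \<le> 2 * real (lvl k) * sqrt (2 ^ k)"
    proof -
      have "(2::real) ^ (2 * ((k + 1) div 2)) \<le> 2 ^ (k + 1)" by (intro power_increasing) auto
      moreover have "(2::real) ^ (2 * ((k + 1) div 2)) = (2 ^ ((k + 1) div 2))\<^sup>2"
        by (subst mult.commute) (rule power_mult)
      moreover have "(2 * sqrt (2 ^ k))\<^sup>2 = 4 * (2::real) ^ k" by (simp add: power_mult_distrib)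
      moreover have "(2::real) ^ (k + 1) \<le> 4 * 2 ^ k" by simp
      ultimately have "((2::real) ^ ((k + 1) div 2))\<^sup>2 \<le> (2 * sqrt (2 ^ k))\<^sup>2"
        by linarith
      then have "(2::real) ^ ((k + 1) div 2) \<le> 2 * sqrt (2 ^ k)"
        by (rule power2_le_imp_le) simp
      then have "real (lvl k) * 2 ^ ((k + 1) div 2) \<le> real (lvl k) * (2 * sqrt (2 ^ k))"
        by (rule mult_left_mono) simp
      then show ?thesis unfolding wid_def by (simp add: mult_ac)
    qed
    have "expectation (low_count k) \<le> (3 * real (wid k)) * ((1 + 2 * K) * real (lvl k))"
      unfolding expectation_low_count
    proof (rule mult_mono)
      have "1 + K + K * real (lvl k) \<le> (1 + 2 * K) * real (lvl k)"
        using L K(1) mult_left_mono[OF L, of "1 + K"] by (simp add: algebra_simps)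
      then show "(\<Sum>l<2 ^ lvl k. G l) \<le> (1 + 2 * K) * real (lvl k)"
        using sumG[of "lvl k"] by simp
    qed (use wL in \<open>auto intro: sum_nonneg G_nonneg\<close>)
    also have "\<dots> \<le> (3 * (2 * real (lvl k) * sqrt (2 ^ k))) * ((1 + 2 * K) * real (lvl k))"
      using \<open>real (wid k) \<le> _\<close> K(1) by (intro mult_right_mono) auto
    also have "\<dots> = 6 * (1 + 2 * K) * sqrt (2 ^ k) * (real (lvl k))\<^sup>2"
      by (simp add: power2_eq_square)
    also have "\<dots> \<le> 6 * (1 + 2 * K) * sqrt (2 ^ k) * (2 * real k powr (1 / 8))\<^sup>2"
    proof (intro mult_left_mono power_mono)
      have "1 \<le> real k powr (1 / 8)" using k by (simp add: ge_one_powr_ge_zero)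
      moreover have "real (lvl k) \<le> real k powr (1 / 8) + 1"
        unfolding lvl_def using powr_ge_zero[of "real k" "1 / 8"] by linarith
      ultimately show "real (lvl k) \<le> 2 * real k powr (1 / 8)" by simp
    qed (use K(1) in auto)
    also have "(2 * real k powr (1 / 8))\<^sup>2 = 4 * real k powr (1 / 4)"
      by (simp add: power_mult_distrib power2_eq_square powr_add[symmetric])
    finally have "expectation (low_count k) / (real k * vol_scale k) \<le>
        6 * (1 + 2 * K) * sqrt (2 ^ k) * (4 * real k powr (1 / 4)) / (real k * vol_scale k)"
      using k by (intro divide_right_mono) (auto simp: vol_scale_def)
    also have "\<dots> = 24 * (1 + 2 * K) * (real k powr (1 / 4) / (real k * sqrt (real k)))"
      using k by (simp add: vol_scale_def real_sqrt_mult field_simps)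
    also have "real k * sqrt (real k) = real k powr (3 / 2)"
      using powr_mult_base[of "real k" "1 / 2"] by (simp add: powr_half_sqrt)
    also have "real k powr (1 / 4) / real k powr (3 / 2) = real k powr (- 5 / 4)"
      by (simp add: powr_diff[symmetric])
    finally show ?thesis .
  qed
  have "AE \<omega> in M. summable (\<lambda>k. low_count k \<omega> / (real k * vol_scale k))"
  proof (rule AE_summable_of_summable_integrals)
    show "integrable M (\<lambda>\<omega>. low_count k \<omega> / (real k * vol_scale k))" for k
      by (intro integrable_divide_zero integrable_low_count)
    show "0 \<le> low_count k \<omega> / (real k * vol_scale k)" for k \<omega>
      by (auto simp: low_count_def vol_scale_def intro!: divide_nonneg_nonneg sum_nonneg)
    show "summable (\<lambda>k. expectation (\<lambda>\<omega>. low_count k \<omega> / (real k * vol_scale k)))"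
    proof (rule summable_comparison_test_ev)
      show "summable (\<lambda>k. 24 * (1 + 2 * K) * real k powr (- 5 / 4))"
        by (intro summable_mult) (simp add: summable_real_powr_iff)
      show "\<forall>\<^sub>F k in sequentially. norm (expectation (\<lambda>\<omega>. low_count k \<omega> / (real k * vol_scale k))) \<le>
          24 * (1 + 2 * K) * real k powr (- 5 / 4)"
        using eventually_ge_at_top[of 1]
      proof eventually_elim
        case (elim k)
        have "0 \<le> expectation (low_count k) / (real k * vol_scale k)"
          by (auto simp: expectation_low_count vol_scale_def intro!: divide_nonneg_nonneg mult_nonneg_nonneg sum_nonneg G_nonneg)
        then show ?case using bound[OF elim] by simp
      qed
    qed
  qed
  then show ?thesis
    by (rule AE_mp) (rule AE_I2, simp add: card_low_verts)
qed


subsection \<open>Boxes are large\<close>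

text \<open>Truncation at height \<open>b\<close> makes these variables bounded, as Hoeffding's
  inequality requires, while a power of the scale still keeps a constant share of the logarithmic
  mean.\<close>

definition tooth_count :: "nat \<Rightarrow> int \<Rightarrow> 'w \<Rightarrow> real" where
  "tooth_count b y \<omega> = (\<Sum>l\<in>{1..b}. indicator {real l..} (H y \<omega>))"

lemma tooth_count_measurable [measurable]: "tooth_count b y \<in> borel_measurable M"
  unfolding tooth_count_def[abs_def] by measurable

lemma tooth_count_bounds: "tooth_count b y \<omega> \<in> {0..real b}"
proof -
  have "tooth_count b y \<omega> \<le> (\<Sum>l\<in>{1..b}. 1)"
    unfolding tooth_count_def by (intro sum_mono) (simp add: indicator_def)
  then show ?thesis by (simp add: tooth_count_def sum_nonneg)
qed

lemma expectation_tooth_count: "expectation (tooth_count b y) = (\<Sum>l\<in>{1..b}. G l)"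
proof -
  have "expectation (tooth_count b y) =
      expectation (\<lambda>\<omega>. \<Sum>l\<in>{1..b}. indicator {\<omega> \<in> space M. real l \<le> H y \<omega>} \<omega>)"
    by (intro Bochner_Integration.integral_cong refl) (auto simp: tooth_count_def indicator_def intro!: sum.cong)
  also have "\<dots> = (\<Sum>l\<in>{1..b}. expectation (indicator {\<omega> \<in> space M. real l \<le> H y \<omega>}))"
    by (intro Bochner_Integration.integral_sum integrable_real_indicator) (auto simp: emeasure_eq_measure)
  also have "\<dots> = (\<Sum>l\<in>{1..b}. G l)"
    by (intro sum.cong refl) (simp add: prob_tooth_ge)
  finally show ?thesis .
qed

lemma sum_tooth_count_le_card_box:
  assumes \<omega>: "\<omega> \<in> space M" and b: "b \<le> r"
  shows "(\<Sum>y\<in>{x..<x + int r}. tooth_count b y \<omega>) \<le> real (card (comb.box (\<lambda>x. H x \<omega>) x r))"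
proof -
  interpret comb "\<lambda>x. H x \<omega>" by (rule comb_sample[OF \<omega>])
  have "tooth_count b y \<omega> = real (card {l \<in> {1..b}. real l \<le> H y \<omega>})" for y
    unfolding real_card_filter[OF finite_atLeastAtMost] tooth_count_def
    by (rule sum.cong[OF refl]) (simp add: indicator_def)
  then have "(\<Sum>y\<in>{x..<x + int r}. tooth_count b y \<omega>) =
      real (card (SIGMA y:{x..<x + int r}. {l \<in> {1..b}. real l \<le> H y \<omega>}))"
    by simp
  also have "\<dots> \<le> real (card (box x r))"
    using b finite_box by (intro of_nat_mono card_mono) (auto simp: box_def)
  finally show ?thesis .
qed

text \<open>Hoeffding with deviation half the mean gives the exponent r m^2 / (2 b^2), where m is
  the mean of one tooth and m >= 1.\<close>

lemma prob_few_teeth: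
  assumes r: "0 < r" and b: "0 < b" and m: "1 \<le> (\<Sum>l\<in>{1..b}. G l)"
  shows "prob {\<omega> \<in> space M. (\<Sum>y\<in>{x..<x + int r}. tooth_count b y \<omega>) \<le> real r * (\<Sum>l\<in>{1..b}. G l) / 2}
    \<le> exp (- real r / (2 * (real b)\<^sup>2))"
proof -
  let ?m = "\<Sum>l\<in>{1..b}. G l"
  interpret Hoeffding_ineq M "{x..<x + int r}" "tooth_count b" "\<lambda>_. 0" "\<lambda>_. real b" "real r * ?m"
  proof unfold_locales
    have "indep_vars (\<lambda>_. borel) (\<lambda>y \<omega>. (\<lambda>h. \<Sum>l\<in>{1..b}. indicat_real {real l..} h) (H y \<omega>)) {x..<x + int r}"
      by (rule indep_vars_compose2[OF indep_vars_subset[OF indep]])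
        (auto intro!: borel_measurable_sum borel_measurable_indicator)
    then show "indep_vars (\<lambda>_. borel) (tooth_count b) {x..<x + int r}"
      by (simp add: tooth_count_def[abs_def])
  qed (use tooth_count_bounds in \<open>auto simp: expectation_tooth_count\<close>)
  have "prob {\<omega> \<in> space M. (\<Sum>y\<in>{x..<x + int r}. tooth_count b y \<omega>) \<le> real r * ?m - real r * ?m / 2}
      \<le> exp (- 2 * (real r * ?m / 2)\<^sup>2 / (\<Sum>i\<in>{x..<x + int r}. (real b - 0)\<^sup>2))"
    using r b m by (intro Hoeffding_ineq_le) auto
  also have "\<dots> \<le> exp (- real r / (2 * (real b)\<^sup>2))"
  proof -
    have "real r * 1 \<le> real r * ?m\<^sup>2" using m by (intro mult_left_mono) auto
    then have "real r / (2 * (real b)\<^sup>2) \<le> real r * ?m\<^sup>2 / (2 * (real b)\<^sup>2)"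
      by (intro divide_right_mono) auto
    also have "\<dots> = 2 * (real r * ?m / 2)\<^sup>2 / (real r * (real b)\<^sup>2)"
      using r by (simp add: power_mult_distrib power_divide power2_eq_square)
    finally show ?thesis by simp
  qed
  finally show ?thesis by simp
qed

text \<open>1/64 is a product: 1/2 from \<open>G_lower\<close>, 1/8 from the truncation exponent,
  1/2 bounding ln 2, and 1/2 to absorb the floor and the initial terms collected in
  \<open>A\<close>.\<close>

lemma tooth_mean_lower: "\<forall>\<^sub>F k in sequentially. C / 64 * real k \<le> (\<Sum>l\<in>{1..2 ^ (k div 8)}. G l)"
proof -
  obtain l\<^sub>0 where l\<^sub>0: "0 < l\<^sub>0" "\<And>l. l\<^sub>0 \<le> l \<Longrightarrow> C / 2 / real l \<le> G l" using G_lower by blast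
  define A :: real where "A = harm l\<^sub>0"
  have "\<forall>\<^sub>F k in sequentially. 32 * (A + 1 / 2) \<le> real k"
    using filterlim_real_sequentially by (simp add: filterlim_at_top)
  then show ?thesis
  proof eventually_elim
    case (elim k)
    have "real k / 32 \<le> (real k / 8 - 1) * (1 / 2) - A"
      using elim by (simp add: field_simps)
    then have k: "C / 64 * real k \<le> C / 2 * ((real k / 8 - 1) * (1 / 2) - A)"
      using mult_left_mono[of "real k / 32" "(real k / 8 - 1) * (1 / 2) - A" "C / 2"] C_pos by simp
    have ln2: "1 / 2 \<le> ln (2 :: real)" using ln2_ge_two_thirds by simp
    let ?b = "2 ^ (k div 8) :: nat"
    have "(real k / 8 - 1) * (1 / 2) \<le> real (k div 8) * (1 / 2)"
      by (intro mult_right_mono) linarith+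
    also have "\<dots> \<le> real (k div 8) * ln 2"
      using ln2 by (intro mult_left_mono) auto
    also have "\<dots> = ln (real ?b)" by (simp add: ln_realpow)
    also have "\<dots> \<le> ln (real ?b + 1)" by (subst ln_le_cancel_iff) (simp_all add: add_pos_pos)
    also have "\<dots> \<le> harm ?b" by (rule ln_le_harm)
    finally have "(real k / 8 - 1) * (1 / 2) - A \<le> harm ?b - A" by linarith
    then have "C / 64 * real k \<le> C / 2 * (harm ?b - A)"
      by (rule order_trans[OF k mult_left_mono]) (use C_pos in simp)
    also have "\<dots> = (\<Sum>l\<in>{1..?b}. C / 2 / real l) - (\<Sum>l\<in>{1..l\<^sub>0}. C / 2 / real l)"
      unfolding A_def harm_def right_diff_distrib sum_distrib_left divide_inverse by (rule refl)
    also have "\<dots> \<le> (\<Sum>l\<in>{1..?b}. G l)"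
    proof -
      \<comment> \<open>\<open>G_lower\<close> holds only from \<open>l\<^sub>0\<close> on, so for
        smaller \<open>l\<close> the term itself is put on the right; these terms are the ones
        subtracted through \<open>A\<close>.\<close>
      have "(\<Sum>l\<in>{1..?b}. C / 2 / real l) \<le> (\<Sum>l\<in>{1..?b} \<union> {1..l\<^sub>0}. (if l \<in> {1..l\<^sub>0} then C / 2 / real l else 0) + (if l \<in> {1..?b} then G l else 0))"
      proof (rule order_trans[OF sum_mono sum_mono2])
        fix l assume "l \<in> {1..?b}"
        then show "C / 2 / real l \<le> (if l \<in> {1..l\<^sub>0} then C / 2 / real l else 0) + (if l \<in> {1..?b} then G l else 0)"
          using l\<^sub>0(2)[of l] G_nonneg[of l] by auto
      qed (use C_pos G_nonneg in auto)
      also have "\<dots> = (\<Sum>l\<in>({1..?b} \<union> {1..l\<^sub>0}) \<inter> {1..l\<^sub>0}. C / 2 / real l) + (\<Sum>l\<in>({1..?b} \<union> {1..l\<^sub>0}) \<inter> {1..?b}. G l)"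
        unfolding sum.distrib by (simp only: sum.inter_restrict[OF finite_UnI[OF finite_atLeastAtMost finite_atLeastAtMost]])
      also have "({1..?b} \<union> {1..l\<^sub>0}) \<inter> {1..l\<^sub>0} = {1..l\<^sub>0}" by blast
      also have "({1..?b} \<union> {1..l\<^sub>0}) \<inter> {1..?b} = {1..?b}" by blast
      finally show ?thesis by simp
    qed
    finally show ?case .
  qed
qed

text \<open>A union bound over at most 9 * 2^k windows is beaten by the Hoeffding exponent, of order
  \<open>rad k\<close> / (b k)^2, that is 2^(k/4) / sqrt k. This is why the truncation height is
  only 2^(k div 8).\<close>

lemma AE_large_boxes:
  "AE \<omega> in M. \<forall>\<^sub>F k in sequentially. \<forall>x. \<bar>x\<bar> \<le> 4 * 2 ^ k \<longrightarrow>
     C / 256 * vol_scale k \<le> real (card (comb.box (\<lambda>x. H x \<omega>) x (rad k)))"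
proof -
  define b :: "nat \<Rightarrow> nat" where "b k = 2 ^ (k div 8)" for k
  define m where "m k = (\<Sum>l\<in>{1..b k}. G l)" for k
  define few where "few k x = {\<omega> \<in> space M. (\<Sum>y\<in>{x..<x + int (rad k)}. tooth_count (b k) y \<omega>) \<le> real (rad k) * m k / 2}" for k x
  define bad where "bad k = (\<Union>x\<in>{- 4 * 2 ^ k..4 * 2 ^ k}. few k x)" for k
  have few_sets [measurable]: "few k x \<in> sets M" for k x
    unfolding few_def by measurable
  have bad_sets: "bad k \<in> sets M" for k
    unfolding bad_def by (intro sets.finite_UN) auto
  have m_large: "\<forall>\<^sub>F k in sequentially. C / 64 * real k \<le> m k"
    using tooth_mean_lower by (simp add: m_def b_def)
  have m_ge_1: "\<forall>\<^sub>F k in sequentially. 1 \<le> m k"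
  proof -
    have "\<forall>\<^sub>F k in sequentially. 64 / C \<le> real k"
      using filterlim_real_sequentially by (simp add: filterlim_at_top)
    then show ?thesis using m_large
      by eventually_elim (use C_pos in \<open>simp add: field_simps\<close>)
  qed
  have "\<forall>\<^sub>F k in sequentially. prob (bad k) \<le> real k powr (- 2)"
  proof -
    have "\<forall>\<^sub>F k in sequentially. 9 * 2 ^ k * exp (- (sqrt (2 ^ k / real k) - 1) / (2 * 2 powr (real k / 4))) \<le> real k powr (- 2)"
      by real_asymp
    then show ?thesis
      using m_ge_1 eventually_large_index
    proof eventually_elim
      case (elim k)
      have b: "0 < b k" by (simp add: b_def)
      have b2: "(real (b k))\<^sup>2 \<le> 2 powr (real k / 4)"
      proof -
        have "(real (b k))\<^sup>2 = 2 powr (real (2 * (k div 8)))"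
          by (simp only: b_def of_nat_power of_nat_numeral power_mult[symmetric] powr_realpow mult.commute zero_less_numeral)
        also have "\<dots> \<le> 2 powr (real k / 4)"
          using of_nat_div_le_of_nat[of k 8, where 'a = real] by (intro powr_mono) auto
        finally show ?thesis .
      qed
      have r: "sqrt (2 ^ k / real k) - 1 \<le> real (rad k)" unfolding rad_def by linarith
      have "prob (bad k) \<le> (\<Sum>x\<in>{- 4 * 2 ^ k..4 * 2 ^ k}. prob (few k x))"
        unfolding bad_def by (intro measure_UNION_le) auto
      also have "\<dots> \<le> (\<Sum>x\<in>{- 4 * 2 ^ k..4 * 2 ^ k :: int}. exp (- real (rad k) / (2 * (real (b k))\<^sup>2)))"
        unfolding few_def m_def
        using rad_bounds(1)[OF elim(3)] b elim(2) by (intro sum_mono prob_few_teeth) (auto simp: m_def)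
      also have "\<dots> = (8 * 2 ^ k + 1) * exp (- real (rad k) / (2 * (real (b k))\<^sup>2))"
        by simp
      also have "\<dots> \<le> 9 * 2 ^ k * exp (- (sqrt (2 ^ k / real k) - 1) / (2 * 2 powr (real k / 4)))"
      proof (intro mult_mono)
        have "(sqrt (2 ^ k / real k) - 1) / (2 * 2 powr (real k / 4)) \<le> real (rad k) / (2 * 2 powr (real k / 4))"
          using r by (intro divide_right_mono) auto
        also have "\<dots> \<le> real (rad k) / (2 * (real (b k))\<^sup>2)"
          using b b2 by (intro divide_left_mono) auto
        finally show "exp (- real (rad k) / (2 * (real (b k))\<^sup>2)) \<le> exp (- (sqrt (2 ^ k / real k) - 1) / (2 * 2 powr (real k / 4)))"
          by (simp only: exp_le_cancel_iff minus_divide_left[symmetric] neg_le_iff_le)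
      qed auto
      also note elim(1)
      finally show ?case .
    qed
  qed
  then have "\<forall>\<^sub>F k in sequentially. norm (prob (bad k)) \<le> real k powr (- 2)"
    by (simp only: real_norm_def abs_of_nonneg[OF measure_nonneg])
  moreover have "summable (\<lambda>k. real k powr (- 2))"
    by (simp add: summable_real_powr_iff)
  ultimately have "summable (\<lambda>k. prob (bad k))"
    by (rule summable_comparison_test_ev)
  then have "AE \<omega> in M. \<forall>\<^sub>F k in sequentially. \<omega> \<in> space M - bad k"
    using bad_sets by (intro borel_cantelli_AE1) (auto simp: emeasure_eq_measure)
  then have good: "AE \<omega> in M. \<forall>\<^sub>F k in sequentially. \<omega> \<in> space M - bad k" .
  have half: "\<forall>\<^sub>F k in sequentially. sqrt (2 ^ k / real k) / 2 \<le> sqrt (2 ^ k / real k) - 1"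
    by real_asymp
  from good show ?thesis
  proof eventually_elim
    case (elim \<omega>)
    show ?case
      using elim m_large eventually_large_index half
    proof eventually_elim
      case (elim k)
      show ?case
      proof (intro allI impI)
        fix x :: int assume x: "\<bar>x\<bar> \<le> 4 * 2 ^ k"
        have bk: "b k \<le> rad k"
        proof -
          have "(2::nat) ^ (k div 8) \<le> 2 ^ (k div 4)" by (intro power_increasing div_le_mono2) auto
          moreover have "2 * 2 ^ (k div 4) \<le> rad k" using elim(3) by (simp only: large_index_def)
          ultimately show ?thesis unfolding b_def by linarith
        qed
        have k: "0 < real k" using elim(3) by (simp add: large_index_def)
        have "\<omega> \<notin> few k x" using elim(1) x by (auto simp: bad_def abs_le_iff)
        then have *: "real (rad k) * m k / 2 \<le> (\<Sum>y\<in>{x..<x + int (rad k)}. tooth_count (b k) y \<omega>)"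
          using elim(1) by (simp add: few_def)
        \<comment> \<open>256 = 2 * 64 * 2: rounding in \<open>rad\<close>, the mean of a tooth, and
          the deviation by half the mean.\<close>
        have "C / 256 * vol_scale k = sqrt (2 ^ k / real k) / 2 * (C / 64 * real k) / 2"
          using k by (simp add: vol_scale_def real_sqrt_mult real_sqrt_divide field_simps)
        also have "\<dots> \<le> real (rad k) * m k / 2"
        proof (intro divide_right_mono mult_mono)
          show "sqrt (2 ^ k / real k) / 2 \<le> real (rad k)"
            using elim(4) unfolding rad_def by linarith
        qed (use elim(2) C_pos k in auto)
        also note *
        also have "(\<Sum>y\<in>{x..<x + int (rad k)}. tooth_count (b k) y \<omega>) \<le> real (card (comb.box (\<lambda>x. H x \<omega>) x (rad k)))"
          using elim(1) bk by (intro sum_tooth_count_le_card_box) auto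
        finally show "C / 256 * vol_scale k \<le> real (card (comb.box (\<lambda>x. H x \<omega>) x (rad k)))" .
      qed
    qed
  qed
qed

lemma AE_finite_triple_collision:
  "AE \<omega> in M. finite_triple_collision_property (comb_verts (\<lambda>x. H x \<omega>)) (comb_edges (\<lambda>x. H x \<omega>))"
  using AE_space AE_large_boxes AE_summable_low_verts
proof eventually_elim
  case (elim \<omega>)
  show ?case
    by (rule comb.finite_triple_collisions[OF comb_sample[OF elim(1)] _ elim(2,3)]) (use C_pos in simp)
qed

end

theorem theorem5p3:
  fixes M :: "'w measure" and H :: "int \<Rightarrow> 'w \<Rightarrow> real" and C :: real
  assumes "prob_space M"
    and "C > 0"
    and "prob_space.indep_vars M (\<lambda>_. borel) H UNIV"
    and "\<And>x. distr M borel (H x) = distr M borel (H 0)"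
    and "\<And>x \<omega>. \<omega> \<in> space M \<Longrightarrow> 0 \<le> H x \<omega>"
    and "((\<lambda>z. z * measure M {\<omega> \<in> space M. H 0 \<omega> > z}) \<longlongrightarrow> C) at_top"
  shows "AE \<omega> in M. finite_triple_collision_property
           (comb_verts (\<lambda>x. H x \<omega>)) (comb_edges (\<lambda>x. H x \<omega>))"
proof -
  interpret prob_space M by fact
  interpret iid_tail_one M H C
    using assms by unfold_locales auto
  show ?thesis by (rule AE_finite_triple_collision)
qed

end
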